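(* Let $0<a<1$, $m>0$ and $l>m-1/a$. Then there is $\delta$ with $1<\delta\le 3/2$ such that, for $z\in\mathbb{C}$ with $\operatorname{Re}(z)>0$, $$\operatorname{E}_{a,m,l}(-z)=\frac{\Gamma(1+a(l-m+1))}{\Gamma(1+a(l-m))}\,z^{-1}+\mathcal{O}(|z|^{-\delta}),\qquad \text{as } |z|\to\infty .$$
   Context: Kilbas-Saigo function: for $a,m>0$, $l>-1/a$, $\operatorname{E}_{a,m,l}(z)=\sum_{n=0}^\infty c_n z^n$ with $c_0=1$ and $c_n=\prod_{k=0}^{n-1}\frac{\Gamma[1+a(km+l)]}{\Gamma[1+a(km+l+1)]}$. *)

theory Defs
  imports "HOL-Analysis.Analysis" "HOL-Library.Landau_Symbols"
begin

definition kilbas_saigo_coeff :: "real \<Rightarrow> real \<Rightarrow> real \<Rightarrow> nat \<Rightarrow> real" where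
  "kilbas_saigo_coeff a m l n =
     (\<Prod>k<n. Gamma (1 + a * (real k * m + l)) / Gamma (1 + a * (real k * m + l + 1)))"

text \<open>
  Meaningful for \<open>a > 0\<close>, \<open>m > 0\<close> and \<open>l > - 1 / a\<close>: then all Gamma arguments are positive
  and the power series converges on the whole complex plane.
\<close>
definition kilbas_saigo :: "real \<Rightarrow> real \<Rightarrow> real \<Rightarrow> complex \<Rightarrow> complex" where
  "kilbas_saigo a m l z = (\<Sum>n. complex_of_real (kilbas_saigo_coeff a m l n) * z ^ n)"

end

theory Submission
  imports Defs "HOL-Complex_Analysis.Complex_Analysis" "HOL-Real_Asymp.Real_Asymp"
begin

text \<open>
  The coefficients \<open>c\<^sub>n\<close> are interpolated by a function \<open>c\<close> holomorphic on a half-plane containing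
  \<open>Re s \<ge> -\<delta>\<close> for some \<open>\<delta> > 1\<close>. Shifting the contour in the Mellin--Barnes integral of
  \<open>c(s) z\<^sup>s \<pi> / sin (\<pi> s)\<close> from far right to \<open>Re s = -\<delta>\<close> collects the power series together with
  \<open>- c(-1) / z\<close>, and leaves a remainder \<open>O(|z|\<^sup>-\<^sup>\<delta>)\<close>, uniformly for \<open>Re z > 0\<close>, provided that
  \<open>c(x + i y)\<close> grows at most like \<open>exp (\<theta> |y|)\<close> with \<open>\<theta> < \<pi> / 2\<close>.

  The interpolating function is a locally uniform limit (along a subsequence, by Montel's theorem) of
  \<open>g(N)\<^sup>s \<Prod>k<N. g(k) / g(s + k)\<close>, where \<open>g(s) = c(s + 1) / c(s)\<close> is a quotient of Gamma values.
  On the real axis these are controlled by the log-convexity of \<open>g\<close>. Vertically, the product formula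
  for Gamma and the convexity of \<open>ln (1 + v\<^sup>2 / r\<^sup>2)\<close> bound them, up to factors polynomial in \<open>y\<close>,
  by \<open>(\<Prod>k\<ge>1. 1 + y\<^sup>2 / k\<^sup>2)\<^sup>a\<^sup>/\<^sup>2\<close>, which is at most \<open>exp (a \<pi> |y| / 2)\<close>; this is where \<open>a < 1\<close> enters.
\<close>

section \<open>Quotients of Gamma values and their size along vertical lines\<close>

definition gamma_quot :: "real \<Rightarrow> 'a::Gamma \<Rightarrow> 'a" where
  "gamma_quot a w = Gamma w / Gamma (w + of_real a)"

lemma Gamma_ne_0_of_Re_pos: "Re z > 0 \<Longrightarrow> Gamma z \<noteq> 0"
  by (auto simp: Gamma_eq_zero_iff elim!: nonpos_Ints_cases)

lemma gamma_quot_of_real: "gamma_quot a (complex_of_real u) = of_real (gamma_quot a u)"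
  by (simp add: gamma_quot_def Gamma_complex_of_real flip: of_real_add)

lemma gamma_quot_pos: "u > 0 \<Longrightarrow> a > 0 \<Longrightarrow> gamma_quot a (u::real) > 0"
  by (simp add: gamma_quot_def)

lemma gamma_quot_ne_0: "Re z > 0 \<Longrightarrow> a > 0 \<Longrightarrow> gamma_quot a z \<noteq> 0"
  by (simp add: gamma_quot_def Gamma_ne_0_of_Re_pos)

lemma gamma_quot_holomorphic:
  assumes "a > 0"
  shows "gamma_quot a holomorphic_on {z. Re z > 0}"
  unfolding gamma_quot_def using assms
  by (intro holomorphic_intros)
     (auto simp: Gamma_eq_zero_iff elim!: nonpos_Ints_cases dest!: arg_cong[where f = Re])

text \<open>Euler's limit formula for 1/Gamma, taken at \<open>u\<close> and at
  \<open>Complex u v\<close>. The factorials cancel, and the powers of n have equal modulus because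
  the real parts agree, so only a quotient of Pochhammer symbols remains.\<close>

lemma Gamma_norm_ratio_LIMSEQ:
  fixes u v :: real
  assumes "u > 0"
  shows "(\<lambda>n. \<Prod>j\<le>n. 1 + v\<^sup>2 / (u + real j)\<^sup>2) \<longlonglongrightarrow> (Gamma u / norm (Gamma (Complex u v)))\<^sup>2"
proof -
  have ratio: "(norm (rGamma_series (Complex u v) n) / rGamma_series u n)\<^sup>2
      = (\<Prod>j\<le>n. 1 + v\<^sup>2 / (u + real j)\<^sup>2)" for n
  proof -
    have poch: "pochhammer u (n + 1) > 0"
      using assms by (intro pochhammer_pos)
    have "norm (rGamma_series (Complex u v) n) / rGamma_series u n
        = norm (pochhammer (Complex u v) (n + 1)) / pochhammer u (n + 1)"
      by (simp add: rGamma_series_def norm_divide norm_mult)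
    also have "\<dots> = (\<Prod>j\<le>n. norm (Complex u v + of_nat j) / (u + real j))"
      by (simp add: pochhammer_Suc_prod prod_norm prod_dividef atLeast0AtMost del: of_nat_Suc)
    also have "\<dots>\<^sup>2 = (\<Prod>j\<le>n. (norm (Complex u v + of_nat j) / (u + real j))\<^sup>2)"
      by (simp add: prod_power_distrib)
    also have "\<dots> = (\<Prod>j\<le>n. 1 + v\<^sup>2 / (u + real j)\<^sup>2)"
    proof (rule prod.cong)
      fix j
      have "u + real j > 0" using assms by simp
      then show "(norm (Complex u v + of_nat j) / (u + real j))\<^sup>2 = 1 + v\<^sup>2 / (u + real j)\<^sup>2"
        by (simp add: power_divide cmod_power2 add_divide_distrib)
    qed simp
    finally show ?thesis .
  qed
  have "rGamma u \<noteq> 0"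
    using assms by (auto simp: rGamma_eq_zero_iff elim!: nonpos_Ints_cases)
  then have "(\<lambda>n. (norm (rGamma_series (Complex u v) n) / rGamma_series u n)\<^sup>2)
      \<longlonglongrightarrow> (norm (rGamma (Complex u v)) / rGamma u)\<^sup>2"
    by (intro tendsto_intros)
  also have "norm (rGamma (Complex u v)) / rGamma u = Gamma u / norm (Gamma (Complex u v))"
    by (simp add: rGamma_inverse_Gamma norm_inverse divide_inverse mult.commute)
  finally show ?thesis
    by (simp add: ratio)
qed

text \<open>The two Gamma products are divided factor by factor, so that the cancellation between
  numerator and denominator is still visible to the bounds below.\<close>

lemma gamma_quot_norm_ratio_LIMSEQ:
  fixes u v a :: real
  assumes "u > 0" "a > 0"
  shows "(\<lambda>n. \<Prod>j\<le>n. (1 + v\<^sup>2 / (u + real j)\<^sup>2) / (1 + v\<^sup>2 / (u + a + real j)\<^sup>2))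
    \<longlonglongrightarrow> (gamma_quot a u / norm (gamma_quot a (Complex u v)))\<^sup>2"
proof -
  have nz: "Gamma (Complex (u + a) v) \<noteq> 0"  "Gamma (Complex u v) \<noteq> 0"
    using assms by (auto intro!: Gamma_ne_0_of_Re_pos)
  have pos: "Gamma (u + a) \<noteq> 0" using Gamma_real_pos[of "u + a"] assms by linarith
  have "(\<lambda>n. (\<Prod>j\<le>n. 1 + v\<^sup>2 / (u + real j)\<^sup>2) / (\<Prod>j\<le>n. 1 + v\<^sup>2 / (u + a + real j)\<^sup>2))
    \<longlonglongrightarrow> (Gamma u / norm (Gamma (Complex u v)))\<^sup>2 / (Gamma (u + a) / norm (Gamma (Complex (u + a) v)))\<^sup>2"
    using assms nz pos by (intro tendsto_divide Gamma_norm_ratio_LIMSEQ) auto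
  also have "(Gamma u / norm (Gamma (Complex u v)))\<^sup>2 / (Gamma (u + a) / norm (Gamma (Complex (u + a) v)))\<^sup>2
     = (gamma_quot a u / norm (gamma_quot a (Complex u v)))\<^sup>2"
  proof -
    have "Complex u v + of_real a = Complex (u + a) v" by (simp add: complex_eq_iff)
    then show ?thesis
      by (simp add: gamma_quot_def norm_divide power_divide power_mult_distrib mult_ac)
  qed
  finally show ?thesis by (simp add: prod_dividef)
qed

text \<open>The derivative -2 v^2 / (r (r^2 + v^2)) increases with r, since both factors of its
  denominator do.\<close>

lemma convex_ln_one_plus_sq:
  fixes v :: real
  shows "convex_on {0<..} (\<lambda>r. ln (1 + v\<^sup>2 / r\<^sup>2))"
proof (rule convex_on_realI)
  show "connected {0::real<..}" by simp
next
  fix r :: real assume r: "r \<in> {0<..}"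
  then have p: "1 + v\<^sup>2 / r\<^sup>2 > 0" by (simp add: add_pos_nonneg)
  have "r\<^sup>2 + v\<^sup>2 > 0" using r by (simp add: add_pos_nonneg)
  then show "((\<lambda>r. ln (1 + v\<^sup>2 / r\<^sup>2)) has_real_derivative (- (2 * v\<^sup>2 / (r * (r\<^sup>2 + v\<^sup>2))))) (at r)"
    using r p
    by - ((rule derivative_eq_intros refl | simp)+, simp add: divide_simps, simp add: algebra_simps eval_nat_numeral)
next
  fix x y :: real assume "x \<in> {0<..}" "y \<in> {0<..}" "x \<le> y"
  then show "- (2 * v\<^sup>2 / (x * (x\<^sup>2 + v\<^sup>2))) \<le> - (2 * v\<^sup>2 / (y * (y\<^sup>2 + v\<^sup>2)))"
    by (intro le_imp_neg_le divide_left_mono mult_mono add_mono mult_pos_pos)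
       (auto intro: add_pos_nonneg power_mono)
qed

text \<open>By convexity the increment of \<open>ln (1 + v\<^sup>2 / r\<^sup>2)\<close> over a step of length \<open>a\<close> is
  at most \<open>a\<close> times the increment over the preceding unit step; the latter telescopes.\<close>
lemma shift_factor_le:
  fixes r v a :: real
  assumes "r > 1" "a > 0"
  shows "(1 + v\<^sup>2 / r\<^sup>2) / (1 + v\<^sup>2 / (r + a)\<^sup>2) \<le>
         ((1 + v\<^sup>2 / (r - 1)\<^sup>2) / (1 + v\<^sup>2 / r\<^sup>2)) powr a"
proof -
  define \<psi> where "\<psi> = (\<lambda>r. ln (1 + v\<^sup>2 / r\<^sup>2))"
  have pos: "1 + v\<^sup>2 / x\<^sup>2 > 0" for x :: real by (simp add: add_pos_nonneg)
  \<comment> \<open>The weight that makes \<open>r\<close> the convex combination of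
    \<open>r - 1\<close> and \<open>r + a\<close>.\<close>
  define t where "t = 1 / (1 + a)"
  have t1: "1 - t = a / (1 + a)" and t2: "(1 + a) * t = 1"
    using assms by (simp_all add: t_def field_simps)
  have "\<psi> ((1 - t) *\<^sub>R (r - 1) + t *\<^sub>R (r + a)) \<le> (1 - t) * \<psi> (r - 1) + t * \<psi> (r + a)"
    unfolding \<psi>_def using assms
    by (intro convex_onD[OF convex_ln_one_plus_sq]) (auto simp: t_def)
  also have "(1 - t) *\<^sub>R (r - 1) + t *\<^sub>R (r + a) = r"
  proof -
    have "(1 + a) * ((1 - t) *\<^sub>R (r - 1) + t *\<^sub>R (r + a))
        = (1 + a - (1 + a) * t) * (r - 1) + ((1 + a) * t) * (r + a)"
      by (simp add: algebra_simps)
    also have "\<dots> = (1 + a) * r"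
      unfolding t2 by (simp add: algebra_simps)
    finally show ?thesis using assms by simp
  qed
  finally have "(1 + a) * \<psi> r \<le> (1 + a) * ((1 - t) * \<psi> (r - 1) + t * \<psi> (r + a))"
    using assms by simp
  also have "\<dots> = a * \<psi> (r - 1) + \<psi> (r + a)"
    using assms by (simp add: t1 distrib_left flip: mult.assoc) (simp add: t2)
  finally have "\<psi> r - \<psi> (r + a) \<le> a * (\<psi> (r - 1) - \<psi> r)"
    by (simp add: algebra_simps)
  then have "exp (\<psi> r - \<psi> (r + a)) \<le> exp (a * (\<psi> (r - 1) - \<psi> r))"
    by simp
  then show ?thesis
    using pos by (simp add: powr_def ln_div exp_diff \<psi>_def less_imp_neq [symmetric])
qed

text \<open>By \<open>shift_factor_le\<close> the product telescopes to a power of f 0 / f (n + 1),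
  and f (n + 1) is at least 1. The exponent \<open>a\<close> is the gain over the next lemma; the
  unit step to the left costs the assumption \<open>u > 1\<close>.\<close>

lemma gamma_quot_norm_ratio_le_powr:
  fixes u v a :: real
  assumes "u > 1" "a > 0"
  shows "(gamma_quot a u / norm (gamma_quot a (Complex u v)))\<^sup>2 \<le> (1 + v\<^sup>2 / (u - 1)\<^sup>2) powr a"
proof (rule LIMSEQ_le_const2[OF gamma_quot_norm_ratio_LIMSEQ])
  have pos: "1 + v\<^sup>2 / x\<^sup>2 > 0" for x :: real by (simp add: add_pos_nonneg)
  define f where "f = (\<lambda>j. 1 + v\<^sup>2 / (u - 1 + real j)\<^sup>2)"
  have "(\<Prod>j\<le>n. (1 + v\<^sup>2 / (u + real j)\<^sup>2) / (1 + v\<^sup>2 / (u + a + real j)\<^sup>2))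
      \<le> (1 + v\<^sup>2 / (u - 1)\<^sup>2) powr a" for n
  proof -
    have "(\<Prod>j\<le>n. (1 + v\<^sup>2 / (u + real j)\<^sup>2) / (1 + v\<^sup>2 / (u + a + real j)\<^sup>2))
        \<le> (\<Prod>j\<le>n. (f j / f (Suc j)) powr a)"
    proof (rule prod_mono, safe)
      fix j
      show "0 \<le> (1 + v\<^sup>2 / (u + real j)\<^sup>2) / (1 + v\<^sup>2 / (u + a + real j)\<^sup>2)"
        using pos[of "u + real j"] pos[of "u + a + real j"] by simp
      show "(1 + v\<^sup>2 / (u + real j)\<^sup>2) / (1 + v\<^sup>2 / (u + a + real j)\<^sup>2) \<le> (f j / f (Suc j)) powr a"
        using shift_factor_le[of "u + real j" a v] assms by (simp add: f_def algebra_simps)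
    qed
    also have "\<dots> = (\<Prod>j\<le>n. f j / f (Suc j)) powr a"
      by (rule prod_powr_distrib [symmetric])
    also have "(\<Prod>j\<le>n. f j / f (Suc j)) = f 0 / f (Suc n)"
    proof (induction n)
      case (Suc n)
      have "f (Suc n) \<noteq> 0" using pos by (simp add: f_def less_imp_neq[symmetric])
      then show ?case using Suc by simp
    qed simp
    also have "\<dots> powr a \<le> f 0 powr a"
    proof (rule powr_mono2)
      have "f (Suc n) \<ge> 1" "f 0 \<ge> 0" by (simp_all add: f_def)
      then show "f 0 / f (Suc n) \<le> f 0" "0 \<le> f 0 / f (Suc n)"
        by (simp_all add: divide_le_eq mult_ge1_I mult_le_cancel_left1)
    qed (use assms in simp)
    finally show ?thesis by (simp add: f_def)
  qed
  then show "\<exists>N. \<forall>n\<ge>N. (\<Prod>j\<le>n. (1 + v\<^sup>2 / (u + real j)\<^sup>2) / (1 + v\<^sup>2 / (u + a + real j)\<^sup>2))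
      \<le> (1 + v\<^sup>2 / (u - 1)\<^sup>2) powr a" by blast
qed (use assms in auto)

text \<open>A cruder bound that reaches down to \<open>u > 0\<close>: as \<open>a \<le> 1\<close>,
  replacing \<open>u + a + j\<close> by \<open>u + j + 1\<close> only shrinks the denominators, and
  the product telescopes. It serves for the finitely many factors that are too far left for the
  previous lemma.\<close>

lemma gamma_quot_norm_ratio_le:
  fixes u v a :: real
  assumes "u > 0" "0 < a" "a \<le> 1"
  shows "(gamma_quot a u / norm (gamma_quot a (Complex u v)))\<^sup>2 \<le> 1 + v\<^sup>2 / u\<^sup>2"
proof (rule LIMSEQ_le_const2[OF gamma_quot_norm_ratio_LIMSEQ])
  have pos: "1 + v\<^sup>2 / x\<^sup>2 > 0" for x :: real by (simp add: add_pos_nonneg)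
  define f where "f = (\<lambda>j. 1 + v\<^sup>2 / (u + real j)\<^sup>2)"
  have "(\<Prod>j\<le>n. (1 + v\<^sup>2 / (u + real j)\<^sup>2) / (1 + v\<^sup>2 / (u + a + real j)\<^sup>2))
      \<le> 1 + v\<^sup>2 / u\<^sup>2" for n
  proof -
    have "(\<Prod>j\<le>n. (1 + v\<^sup>2 / (u + real j)\<^sup>2) / (1 + v\<^sup>2 / (u + a + real j)\<^sup>2))
        \<le> (\<Prod>j\<le>n. f j / f (Suc j))"
    proof (rule prod_mono, safe)
      fix j
      show "0 \<le> (1 + v\<^sup>2 / (u + real j)\<^sup>2) / (1 + v\<^sup>2 / (u + a + real j)\<^sup>2)"
        using pos[of "u + real j"] pos[of "u + a + real j"] by simp
      have "f (Suc j) \<le> 1 + v\<^sup>2 / (u + a + real j)\<^sup>2"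
        unfolding f_def using assms by (intro add_left_mono divide_left_mono power_mono) auto
      then show "(1 + v\<^sup>2 / (u + real j)\<^sup>2) / (1 + v\<^sup>2 / (u + a + real j)\<^sup>2) \<le> f j / f (Suc j)"
        using pos[of "u + real j"] pos[of "u + real (Suc j)"] pos[of "u + a + real j"]
        unfolding f_def by (intro divide_left_mono mult_pos_pos) auto
    qed
    also have "(\<Prod>j\<le>n. f j / f (Suc j)) = f 0 / f (Suc n)"
    proof (induction n)
      case (Suc n)
      have "f (Suc n) \<noteq> 0" using pos by (simp add: f_def less_imp_neq[symmetric])
      then show ?case using Suc by simp
    qed simp
    also have "\<dots> \<le> f 0"
    proof -
      have "f (Suc n) \<ge> 1" "f 0 \<ge> 0" by (simp_all add: f_def)
      then show "f 0 / f (Suc n) \<le> f 0"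
        by (simp_all add: divide_le_eq mult_ge1_I mult_le_cancel_left1)
    qed
    finally show ?thesis by (simp add: f_def)
  qed
  then show "\<exists>N. \<forall>n\<ge>N. (\<Prod>j\<le>n. (1 + v\<^sup>2 / (u + real j)\<^sup>2) / (1 + v\<^sup>2 / (u + a + real j)\<^sup>2))
      \<le> 1 + v\<^sup>2 / u\<^sup>2" by blast
qed (use assms in auto)

text \<open>Euler's sine product at iy shows that the partial products increase to sinh (pi y) / (pi
  y), and sinh t is at most t exp t for nonnegative t.\<close>

lemma prod_one_plus_sq_le_exp:
  fixes y :: real
  shows "(\<Prod>k<N. 1 + y\<^sup>2 / (real k + 1)\<^sup>2) \<le> exp (pi * \<bar>y\<bar>)"
proof (cases "y = 0")
  case False
  define P where "P = (\<lambda>n. \<Prod>k<n. 1 + y\<^sup>2 / (real k + 1)\<^sup>2)"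
  have inc: "incseq P"
  proof (rule incseq_SucI)
    fix n
    have "P n \<ge> 0" by (simp add: P_def prod_nonneg)
    then show "P n \<le> P (Suc n)" by (simp add: P_def mult_le_cancel_left1)
  qed
  have "(\<lambda>n. norm (of_real pi * (\<i> * of_real y) * (\<Prod>k=1..n. 1 - (\<i> * of_real y)\<^sup>2 / of_nat k^2)))
      \<longlonglongrightarrow> norm (sin (of_real pi * (\<i> * complex_of_real y)))"
    by (intro tendsto_norm sin_product_formula_complex)
  also have "(\<lambda>n. norm (of_real pi * (\<i> * of_real y) * (\<Prod>k=1..n. 1 - (\<i> * of_real y)\<^sup>2 / of_nat k^2)))
     = (\<lambda>n. pi * \<bar>y\<bar> * P n)"
  proof
    fix n
    have "(\<Prod>k=1..n. 1 - (\<i> * complex_of_real y)\<^sup>2 / of_nat k^2) = of_real (\<Prod>k=1..n. 1 + y\<^sup>2 / (real k)\<^sup>2)"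
      unfolding of_real_prod by (intro prod.cong) (simp_all add: power_mult_distrib)
    also have "(\<Prod>k=1..n. 1 + y\<^sup>2 / (real k)\<^sup>2) = P n"
      unfolding P_def
      by (rule prod.reindex_bij_witness[of _ "\<lambda>k. k + 1" "\<lambda>k. k - 1"]) auto
    finally have eq: "(\<Prod>k=1..n. 1 - (\<i> * complex_of_real y)\<^sup>2 / of_nat k^2) = of_real (P n)" .
    have "P n \<ge> 0" by (simp add: P_def prod_nonneg)
    then show "norm (of_real pi * (\<i> * of_real y) * (\<Prod>k=1..n. 1 - (\<i> * of_real y)\<^sup>2 / of_nat k^2)) = pi * \<bar>y\<bar> * P n"
      unfolding eq by (simp add: norm_mult)
  qed
  finally have lim: "(\<lambda>n. pi * \<bar>y\<bar> * P n) \<longlonglongrightarrow> norm (sin (of_real pi * (\<i> * complex_of_real y)))" .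
  have "incseq (\<lambda>n. pi * \<bar>y\<bar> * P n)"
    using inc by (auto simp: incseq_def intro!: mult_left_mono)
  from incseq_le[OF this lim] have "pi * \<bar>y\<bar> * P N \<le> norm (sin (of_real pi * (\<i> * complex_of_real y)))" .
  also have "\<dots> = norm (sin (\<i> * complex_of_real (pi * y)))" by (simp add: mult_ac)
  also have "\<dots> = \<bar>sinh (pi * y)\<bar>"
    proof -
    have "sin (\<i> * complex_of_real (pi * y)) = \<i> * of_real (sinh (pi * y))"
      by (simp add: sin_i_times sinh_field_def exp_minus del: of_real_mult flip: exp_of_real)
    then show ?thesis by (simp only: norm_mult norm_of_real) simp
  qed
  also have "\<dots> = sinh (pi * \<bar>y\<bar>)"
    by (simp add: abs_mult flip: sinh_real_abs del: sinh_real_abs)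
     
  also have "\<dots> \<le> pi * \<bar>y\<bar> * exp (pi * \<bar>y\<bar>)"
  proof -
    define t where "t = pi * \<bar>y\<bar>"
    \<comment> \<open>Multiplied by exp t, this becomes exp t - exp (-t) <= 2 t exp t.\<close>
    have "1 + (- 2 * t) \<le> exp (- 2 * t)" by (rule exp_ge_add_one_self)
    then have "exp t * (1 - 2 * t) \<le> exp t * exp (- 2 * t)" by (intro mult_left_mono) auto
    also have "\<dots> = exp (- t)" by (simp flip: exp_add)
    finally show ?thesis unfolding t_def[symmetric] by (simp add: sinh_def algebra_simps)
  qed
  finally show ?thesis using False by (simp add: P_def)
qed simp

text \<open>The first \<open>k0\<close> factors get the crude bound, linear in |y|; the others get
  the sharp one, and their product is at most exp (a pi |y| / 2). The polynomial from the first
  group is absorbed into exp (\<open>\<eta>\<close> |y|). The constant depends neither on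
  \<open>N\<close> nor on \<open>u\<close>.\<close>

lemma prod_gamma_quot_ratio_bound:
  fixes a b u0 \<eta> :: real
  assumes "0 < a" "a < 1" "b > 0" "u0 > 0" "\<eta> > 0"
  obtains C where "C > 0"
    "\<And>u y N. u \<ge> u0 \<Longrightarrow>
       (\<Prod>k<N. gamma_quot a (u + b * real k) / norm (gamma_quot a (Complex (u + b * real k) (b * y))))
       \<le> C * exp ((a * pi / 2 + \<eta>) * \<bar>y\<bar>)"
proof -
  \<comment> \<open>From index \<open>k0\<close> on, \<open>u + b * k - 1\<close> is at least
    \<open>b * (k - k0 + 1)\<close>, so the sharp bound can be compared with the factors of the sine
    product.\<close>
  obtain k0 :: nat where "(1 + b) / b \<le> real k0"
    using real_arch_simple by blast
  then have k0: "1 + b \<le> b * real k0"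
    using assms by (simp add: field_simps)
  define c where "c = b / u0"
  \<comment> \<open>\<open>\<epsilon>\<close> shares \<open>\<eta>\<close> among the
    \<open>k0\<close> crude factors, and \<open>M\<close> is chosen so that 1 + c |y| <= M exp
    (\<open>\<epsilon>\<close> |y|).\<close>
  define \<epsilon> where "\<epsilon> = \<eta> / (real k0 + 1)"
  define M where "M = max 1 (c / \<epsilon>)"
  have eps: "\<epsilon> > 0" "real k0 * \<epsilon> \<le> \<eta>"
    using assms by (auto simp: \<epsilon>_def field_simps)
  have M: "M \<ge> 1" "c \<le> M * \<epsilon>"
    using eps by (auto simp: M_def max_def field_simps)
  have bound: "(\<Prod>k<N. gamma_quot a (u + b * real k) / norm (gamma_quot a (Complex (u + b * real k) (b * y))))
       \<le> M ^ k0 * exp ((a * pi / 2 + \<eta>) * \<bar>y\<bar>)" if u: "u \<ge> u0" for u y :: real and N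
  proof -
    define F where "F = (\<lambda>k. gamma_quot a (u + b * real k) / norm (gamma_quot a (Complex (u + b * real k) (b * y))))"
    define X where "X = 1 + c * \<bar>y\<bar>"
    define Y where "Y = (\<lambda>j. (1 + y\<^sup>2 / (real j + 1)\<^sup>2) powr (a / 2))"
    define G where "G = (\<lambda>k. if k < k0 then X else Y (k - k0))"
    have uk: "u + b * real k \<ge> u0" "u + b * real k > 0" for k
      using u assms by (auto intro: add_pos_nonneg add_increasing2)
    have X1: "X \<ge> 1" using assms by (simp add: X_def c_def)
    have Y1: "Y j \<ge> 1" for j
      unfolding Y_def using assms by (intro ge_one_powr_ge_zero) auto
    have F0: "F k \<ge> 0" for k
      unfolding F_def using gamma_quot_pos[OF uk(2)[of k] assms(1)] by simp
    have FX: "F k \<le> X" for k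
    proof (rule power2_le_imp_le)
      have "(F k)\<^sup>2 \<le> 1 + (b * y)\<^sup>2 / (u + b * real k)\<^sup>2"
        unfolding F_def using assms uk[of k] by (intro gamma_quot_norm_ratio_le) auto
      also have "\<dots> \<le> 1 + (b * y)\<^sup>2 / u0\<^sup>2"
        using assms uk[of k] by (intro add_left_mono divide_left_mono power_mono) auto
      also have "\<dots> = 1 + (c * \<bar>y\<bar>)\<^sup>2"
        by (simp add: c_def power_mult_distrib power_divide)
      also have "\<dots> \<le> X\<^sup>2"
        using assms by (simp add: X_def power2_sum c_def)
      finally show "(F k)\<^sup>2 \<le> X\<^sup>2" .
    qed (use X1 in simp)
    have FY: "F k \<le> Y (k - k0)" if k: "k \<ge> k0" for k
    proof (rule power2_le_imp_le)
      have uk1: "b * (real (k - k0) + 1) \<le> u + b * real k - 1"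
        using k k0 u assms by (simp add: of_nat_diff algebra_simps)
      have pos: "b * (real (k - k0) + 1) > 0"
        using assms by simp
      have "(F k)\<^sup>2 \<le> (1 + (b * y)\<^sup>2 / (u + b * real k - 1)\<^sup>2) powr a"
        unfolding F_def using assms uk1 pos by (intro gamma_quot_norm_ratio_le_powr) linarith+
      also have "\<dots> \<le> (1 + (b * y)\<^sup>2 / (b * (real (k - k0) + 1))\<^sup>2) powr a"
      proof (intro powr_mono2 add_left_mono divide_left_mono power_mono mult_pos_pos zero_less_power)
        show "0 < u + b * real k - 1" using uk1 pos by linarith
      qed (use assms uk1 pos in \<open>auto intro: add_nonneg_nonneg\<close>)
      also have "(b * y)\<^sup>2 / (b * (real (k - k0) + 1))\<^sup>2 = y\<^sup>2 / (real (k - k0) + 1)\<^sup>2"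
        using assms by (simp add: power_mult_distrib)
      also have "(1 + y\<^sup>2 / (real (k - k0) + 1)\<^sup>2) powr a = (Y (k - k0))\<^sup>2"
        by (simp add: Y_def power2_eq_square flip: powr_add)
      finally show "(F k)\<^sup>2 \<le> (Y (k - k0))\<^sup>2" .
    qed (use Y1[of "k - k0"] in simp)
    have "(\<Prod>k<N. F k) \<le> (\<Prod>k<N. G k)"
      using F0 FX FY by (intro prod_mono) (auto simp: G_def)
    \<comment> \<open>All factors are at least 1, so lengthening the product lets it split at
      \<open>k0\<close> whatever \<open>N\<close> is.\<close>
    also have "\<dots> \<le> (\<Prod>k<k0 + N. G k)"
      using X1 Y1 by (intro prod_mono2) (auto simp: G_def intro: order_trans[OF zero_le_one])
    also have "\<dots> = X ^ k0 * (\<Prod>j<N. Y j)"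
      by (induction N) (auto simp: G_def)
    finally have FXY: "(\<Prod>k<N. F k) \<le> X ^ k0 * (\<Prod>j<N. Y j)" .
    have "(\<Prod>j<N. Y j) = (\<Prod>j<N. 1 + y\<^sup>2 / (real j + 1)\<^sup>2) powr (a / 2)"
      unfolding Y_def by (simp add: prod_powr_distrib)
    also have "\<dots> \<le> exp (pi * \<bar>y\<bar>) powr (a / 2)"
      using assms by (intro powr_mono2 prod_one_plus_sq_le_exp prod_nonneg) (auto intro: add_nonneg_nonneg)
    also have "\<dots> = exp (a * pi / 2 * \<bar>y\<bar>)"
      by (simp add: powr_def mult_ac)
    finally have Yle: "(\<Prod>j<N. Y j) \<le> exp (a * pi / 2 * \<bar>y\<bar>)" .
    have Xle: "X ^ k0 \<le> M ^ k0 * exp (\<eta> * \<bar>y\<bar>)"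
    proof -
      have "X \<le> M * exp (\<epsilon> * \<bar>y\<bar>)"
      proof -
        have "X \<le> M + M * \<epsilon> * \<bar>y\<bar>"
          unfolding X_def using M by (intro add_mono mult_right_mono) auto
        also have "\<dots> = M * (1 + \<epsilon> * \<bar>y\<bar>)" by (simp add: algebra_simps)
        also have "\<dots> \<le> M * exp (\<epsilon> * \<bar>y\<bar>)"
          using M by (intro mult_left_mono exp_ge_add_one_self) auto
        finally show ?thesis .
      qed
      then have "X ^ k0 \<le> (M * exp (\<epsilon> * \<bar>y\<bar>)) ^ k0"
        using X1 by (intro power_mono) auto
      also have "\<dots> = M ^ k0 * exp (real k0 * \<epsilon> * \<bar>y\<bar>)"
        by (simp add: power_mult_distrib mult_ac flip: exp_of_nat_mult)
      also have "\<dots> \<le> M ^ k0 * exp (\<eta> * \<bar>y\<bar>)"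
        using M eps by (intro mult_left_mono) (auto intro: mult_right_mono)
      finally show ?thesis .
    qed
    note FXY
    also have "X ^ k0 * (\<Prod>j<N. Y j) \<le> (M ^ k0 * exp (\<eta> * \<bar>y\<bar>)) * exp (a * pi / 2 * \<bar>y\<bar>)"
      using Xle Yle M Y1 by (intro mult_mono prod_nonneg) (auto intro: order_trans[OF zero_le_one])
    also have "\<dots> = M ^ k0 * exp ((a * pi / 2 + \<eta>) * \<bar>y\<bar>)"
      by (simp add: distrib_right add.commute flip: exp_add)
    finally show ?thesis by (simp add: F_def)
  qed
  show ?thesis
    using that[of "M ^ k0"] bound M by auto
qed

section \<open>The Gamma quotient on the real axis: log-convexity and asymptotics\<close>

text \<open>The second derivative is a difference of trigamma values, nonnegative because the
  trigamma function decreases on the positive axis.\<close>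

lemma convex_ln_gamma_quot:
  assumes "a > 0"
  shows "convex_on {0<..} (\<lambda>x::real. ln (gamma_quot a x))"
proof -
  show ?thesis
  proof (rule f''_ge0_imp_convex)
    fix x :: real assume x: "x \<in> {0<..}"
    have nn: "x \<notin> \<int>\<^sub>\<le>\<^sub>0" "x + a \<notin> \<int>\<^sub>\<le>\<^sub>0"
      using x assms by (auto elim!: nonpos_Ints_cases)
    have "((\<lambda>x. ln_Gamma x - ln_Gamma (x + a)) has_real_derivative (Digamma x - Digamma (x + a))) (at x)"
      using x assms by (auto intro!: derivative_eq_intros)
    then show "((\<lambda>x. ln (gamma_quot a x)) has_real_derivative (Digamma x - Digamma (x + a))) (at x)"
      by (rule has_field_derivative_transform_within_open[of _ _ _ "{0<..}"])
         (use x assms in \<open>auto simp: gamma_quot_def ln_divide_pos ln_Gamma_real_pos\<close>)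
    show "((\<lambda>x. Digamma x - Digamma (x + a)) has_real_derivative (Polygamma 1 x - Polygamma 1 (x + a))) (at x)"
      using nn by (auto intro!: derivative_eq_intros)
    show "Polygamma 1 x - Polygamma 1 (x + a) \<ge> 0"
      using Polygamma_real_strict_antimono[of x "x + a" 1] x assms by simp
  qed simp
qed

text \<open>Log-convexity of Gamma between \<open>u\<close> and \<open>u + 1\<close>, combined with
  Gamma (u + 1) = u Gamma u.\<close>

lemma Gamma_add_le:
  fixes u a :: real
  assumes "u > 0" "0 \<le> a" "a \<le> 1"
  shows "Gamma (u + a) \<le> Gamma u * u powr a"
proof -
  have "(ln \<circ> Gamma) ((1 - a) *\<^sub>R u + a *\<^sub>R (u + 1)) \<le> (1 - a) * (ln \<circ> Gamma) u + a * (ln \<circ> Gamma) (u + 1)"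
    using assms by (intro convex_onD[OF log_convex_Gamma_real]) auto
  moreover have "(1 - a) *\<^sub>R u + a *\<^sub>R (u + 1) = u + a" by (simp add: algebra_simps)
  moreover have "Gamma (u + 1) = u * Gamma u"
    using assms by (intro Gamma_plus1) (auto elim!: nonpos_Ints_cases)
  moreover have "ln (u * Gamma u) = ln u + ln (Gamma u)"
    using assms by (intro ln_mult_pos) auto
  ultimately have "ln (Gamma (u + a)) \<le> ln (Gamma u) + a * ln u"
    by (simp add: algebra_simps del: ln_mult)
  then have "exp (ln (Gamma (u + a))) \<le> exp (ln (Gamma u) + a * ln u)" by simp
  then show ?thesis using assms by (simp add: exp_add powr_def)
qed

text \<open>\<open>Gamma_add_le\<close> is used twice: a step \<open>a\<close> from \<open>u\<close>
  gives the lower bound, and a step \<open>1 - a\<close> from \<open>u + a\<close>, which lands on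
  \<open>u + 1\<close>, gives the upper one.\<close>

lemma gamma_quot_asymp:
  assumes "0 < a" "a < 1"
  shows "((\<lambda>u::real. gamma_quot a u * u powr a) \<longlongrightarrow> 1) at_top"
proof (rule tendsto_sandwich)
  show "\<forall>\<^sub>F u in at_top. 1 \<le> gamma_quot a (u::real) * u powr a"
    using eventually_gt_at_top[of 0]
  proof eventually_elim
    case (elim u)
    then show ?case
      using Gamma_add_le[of u a] assms by (simp add: gamma_quot_def field_simps)
  qed
  show "\<forall>\<^sub>F u in at_top. gamma_quot a (u::real) * u powr a \<le> (u + a) powr (1 - a) / u * u powr a"
    using eventually_gt_at_top[of 0]
  proof eventually_elim
    case (elim u)
    have "Gamma (u + 1) = u * Gamma u"
      using elim by (intro Gamma_plus1) (auto elim!: nonpos_Ints_cases)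
    then have "u * Gamma u \<le> Gamma (u + a) * (u + a) powr (1 - a)"
      using Gamma_add_le[of "u + a" "1 - a"] elim assms by simp
    then have "gamma_quot a u \<le> (u + a) powr (1 - a) / u"
      using elim assms by (simp add: gamma_quot_def field_simps)
    then show ?case by (intro mult_right_mono) auto
  qed
  show "((\<lambda>u. (u + a) powr (1 - a) / u * u powr a) \<longlongrightarrow> 1) at_top"
    using assms by real_asymp
qed simp

lemma gamma_quot_shift_tendsto:
  assumes "0 < a" "a < 1"
  shows "((\<lambda>u::real. gamma_quot a u / gamma_quot a (u + d)) \<longlongrightarrow> 1) at_top"
proof -
  define f where "f = (\<lambda>u::real. gamma_quot a u * u powr a)"
  have f: "(f \<longlongrightarrow> 1) at_top" unfolding f_def by (rule gamma_quot_asymp[OF assms])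
  have "filterlim (\<lambda>u::real. u + d) at_top at_top"
    by real_asymp
  then have "((\<lambda>u. f (u + d)) \<longlongrightarrow> 1) at_top"
    by (rule filterlim_compose[OF f])
  moreover have "((\<lambda>u. (u + d) powr a / u powr a) \<longlongrightarrow> 1) at_top"
    using assms by real_asymp
  ultimately have "((\<lambda>u. f u / f (u + d) * ((u + d) powr a / u powr a)) \<longlongrightarrow> 1 / 1 * 1) at_top"
    using f by (intro tendsto_intros) auto
  moreover have "\<forall>\<^sub>F u in at_top. f u / f (u + d) * ((u + d) powr a / u powr a)
      = gamma_quot a u / gamma_quot a (u + d)"
    using eventually_gt_at_top[of "max 0 (-d)"]
    by eventually_elim (auto simp: f_def)
  ultimately show ?thesis
    by (simp add: filterlim_cong)
qed

lemma gamma_quot_tendsto_0: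
  assumes "0 < a" "a < 1"
  shows "((\<lambda>u::real. gamma_quot a u) \<longlongrightarrow> 0) at_top"
proof -
  have "((\<lambda>u::real. u powr (-a)) \<longlongrightarrow> 0) at_top"
    using assms by real_asymp
  from tendsto_mult[OF gamma_quot_asymp[OF assms] this]
  have "((\<lambda>u::real. gamma_quot a u * u powr a * u powr (-a)) \<longlongrightarrow> 0) at_top" by simp
  moreover have "\<forall>\<^sub>F u in at_top. gamma_quot a u * u powr a * u powr (-a) = gamma_quot a (u::real)"
    using eventually_gt_at_top[of 0]
    by eventually_elim (simp add: powr_minus)
  ultimately show ?thesis by (simp add: filterlim_cong)
qed

section \<open>Estimates for the sine kernel and for vertical integrals\<close>

text \<open>|Re (sin w)| = |sin (Re w)| cosh (Im w). Suited to vertical lines, where sin (Re w) is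
  constant.\<close>

lemma norm_sin_ge_of_Re: "norm (sin w) \<ge> \<bar>sin (Re w)\<bar> * exp \<bar>Im w\<bar> / 2" for w :: complex
proof -
  have "\<bar>sin (Re w)\<bar> * exp \<bar>Im w\<bar> / 2 \<le> \<bar>sin (Re w)\<bar> * (exp (Im w) + exp (- Im w)) / 2"
    by (intro divide_right_mono mult_left_mono) (auto simp: abs_if)
  also have "\<dots> = \<bar>Re (sin w)\<bar>"
    unfolding Re_sin by (simp add: abs_mult)
  also have "\<dots> \<le> norm (sin w)" by (rule abs_Re_le_cmod)
  finally show ?thesis .
qed

text \<open>Suited to horizontal lines, where sin (Re w) may vanish: the bound is uniform in Re w
  because only cos (2 Re w) <= 1 is used.\<close>

lemma norm_sin_ge_of_Im:
  fixes w :: complex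
  assumes "\<bar>Im w\<bar> \<ge> 1"
  shows "norm (sin w) \<ge> exp \<bar>Im w\<bar> / 4"
proof (rule power2_le_imp_le)
  define t where "t = \<bar>Im w\<bar>"
  have t: "t \<ge> 1" using assms by (simp add: t_def)
  have e: "exp t * exp (- t) = 1" by (simp flip: exp_add)
  have "exp 1 \<le> exp t" using t by simp
  then have "exp t \<ge> 2" using exp_ge_add_one_self[of 1] by linarith
  then have et: "(exp t)\<^sup>2 \<ge> 4" using power_mono[of 2 "exp t" 2] by simp
  have "(exp t / 4)\<^sup>2 \<le> ((exp t)\<^sup>2 + (exp (- t))\<^sup>2 - 2) / 4"
    using et by (simp add: power_divide) (smt (verit) zero_le_power2)
  also have "\<dots> = (exp (2 * t) + exp (- (2 * t)) - 2) / 4"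
    by (simp add: power2_eq_square flip: exp_add)
  also have "\<dots> = (exp (2 * Im w) + inverse (exp (2 * Im w)) - 2) / 4"
    by (auto simp: t_def abs_if exp_minus)
  also have "\<dots> \<le> (exp (2 * Im w) + inverse (exp (2 * Im w)) - 2 * cos (2 * Re w)) / 4"
    by (intro divide_right_mono diff_left_mono) auto
  also have "\<dots> = (norm (sin w))\<^sup>2" by (rule norm_sin_squared [symmetric])
  finally show "(exp \<bar>Im w\<bar> / 4)\<^sup>2 \<le> (norm (sin w))\<^sup>2" by (simp add: t_def)
qed simp

text \<open>Replaces exponential decay by a majorant whose primitive is a multiple of
  arctan.\<close>

lemma exp_neg_le_inverse_quadratic:
  fixes \<eta> :: real
  assumes "\<eta> > 0"
  obtains K where "K > 0" "\<And>y. exp (- \<eta> * \<bar>y\<bar>) \<le> K / (1 + y\<^sup>2)"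
proof
  define K where "K = max 1 (2 / \<eta>\<^sup>2)"
  show "K > 0" by (simp add: K_def)
  fix y :: real
  have pos: "1 + y\<^sup>2 > 0" by (simp add: add_pos_nonneg)
  have K: "K \<ge> 1" "K * (\<eta>\<^sup>2 / 2) \<ge> 1"
    using assms by (auto simp: K_def max_def field_simps)
  have "1 + y\<^sup>2 \<le> K * 1 + K * (\<eta>\<^sup>2 / 2) * y\<^sup>2"
    using K mult_right_mono[OF K(2), of "y\<^sup>2"] by simp
  also have "\<dots> \<le> K * (1 + \<eta> * \<bar>y\<bar> + (\<eta> * \<bar>y\<bar>)\<^sup>2 / 2)"
    using assms K by (simp add: distrib_left power_mult_distrib)
  also have "\<dots> \<le> K * exp (\<eta> * \<bar>y\<bar>)"
    using assms K by (intro mult_left_mono exp_lower_Taylor_quadratic) auto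
  finally show "exp (- \<eta> * \<bar>y\<bar>) \<le> K / (1 + y\<^sup>2)"
    using pos by (simp add: exp_minus field_simps)
qed

text \<open>The majorant has the primitive B arctan y, so the bound does not depend on the height
  \<open>T\<close>.\<close>

lemma norm_contour_integral_vertical_le:
  assumes "continuous_on (closed_segment (Complex x (- T)) (Complex x T)) f" "T > 0"
    and bound: "\<And>y. \<bar>y\<bar> \<le> T \<Longrightarrow> norm (f (Complex x y)) \<le> B / (1 + y\<^sup>2)"
  shows "norm (contour_integral (linepath (Complex x (- T)) (Complex x T)) f) \<le> B * pi"
proof -
  define I where "I = contour_integral (linepath (Complex x (- T)) (Complex x T)) f"
  have B: "B \<ge> 0" using bound[of 0] assms(2) by (simp add: order_trans[OF norm_ge_zero])
  have "f contour_integrable_on linepath (Complex x (- T)) (Complex x T)"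
    by (rule contour_integrable_continuous_linepath) (rule assms(1))
  then have "(f has_contour_integral I) (linepath (Complex x (- T)) (Complex x T))"
    unfolding I_def by (rule has_contour_integral_integral)
  then have "((\<lambda>y. f (Complex x y)) has_integral (- \<i> * I)) {-T..T}"
    using assms(2) by (subst (asm) has_contour_integral_linepath_same_Re_iff) auto
  moreover have "((\<lambda>y. B / (1 + y\<^sup>2)) has_integral (B * arctan T - B * arctan (-T))) {-T..T}"
  proof (rule fundamental_theorem_of_calculus)
    fix y :: real
    have "1 + y\<^sup>2 \<noteq> 0" by (smt (verit) zero_le_power2)
    then show "((\<lambda>y. B * arctan y) has_vector_derivative B / (1 + y\<^sup>2)) (at y within {-T..T})"
      unfolding has_real_derivative_iff_has_vector_derivative[symmetric]
      by (auto intro!: derivative_eq_intros simp: divide_inverse)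
  qed (use assms in simp)
  ultimately have "norm (- \<i> * I) \<le> B * arctan T - B * arctan (-T)"
    using bound integral_norm_bound_integral[of "\<lambda>y. f (Complex x y)" "{-T..T}" "\<lambda>y. B / (1 + y\<^sup>2)"]
    by (auto simp: integral_unique has_integral_integrable abs_le_iff)
  also have "\<dots> = B * (2 * arctan T)" by (simp add: arctan_minus)
  also have "\<dots> \<le> B * pi"
    using B arctan_ubound[of T] by (intro mult_left_mono) linarith+
  finally show ?thesis by (simp add: I_def norm_mult)
qed

section \<open>Residues and the shift of the Mellin-Barnes contour\<close>

lemma residue_divide_sin_pi:
  assumes "open U" "of_int k \<in> U" "h holomorphic_on U"
  shows "residue (\<lambda>s. h s / sin (of_real pi * s)) (of_int k) = h (of_int k) / (of_real pi * (if even k then 1 else - 1))"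
proof -
  \<comment> \<open>Radius 1 keeps all other integers, hence all other zeros of sin (pi s),
    outside.\<close>
  define V where "V = U \<inter> ball (of_int k :: complex) 1"
  have sin_ne: "sin (of_real pi * s) \<noteq> 0" if "s \<in> V" "s \<noteq> of_int k" for s
  proof
    assume "sin (of_real pi * s) = 0"
    then obtain n :: int where "of_real pi * s = of_real (of_int n * pi)" unfolding sin_eq_0 by blast
    then have s: "s = of_int n" by (simp add: mult.commute)
    have "norm (of_int k - of_int n :: complex) < 1" using that(1) by (simp add: V_def s dist_norm)
    then have "\<bar>k - n\<bar> < 1" by (metis norm_of_int of_int_diff of_int_less_1_iff of_int_abs)
    then show False using that(2) s by simp
  qed
  have cosk: "cos (of_real pi * of_int k :: complex) = (if even k then 1 else - 1)"
    by (metis cos_npi_int cos_of_real of_real_1 of_real_minus of_real_mult of_real_of_int_eq)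
  have sink: "sin (of_real pi * of_int k :: complex) = 0"
    unfolding sin_eq_0 by (intro exI[of _ k]) simp
  show ?thesis
  proof (rule residue_simple'[of V])
    show "open V" "of_int k \<in> V" using assms by (auto simp: V_def)
    show "(\<lambda>s. h s / sin (of_real pi * s)) holomorphic_on V - {of_int k}"
      using assms(3) sin_ne by (intro holomorphic_intros) (auto simp: V_def elim: holomorphic_on_subset)
    have "((\<lambda>s. sin (of_real pi * s)) has_field_derivative (of_real pi * cos (of_real pi * of_int k))) (at (of_int k :: complex))"
      by (auto intro!: derivative_eq_intros)
    then have "((\<lambda>s::complex. sin (of_real pi * s) / (s - of_int k)) \<longlongrightarrow> of_real pi * (if even k then 1 else - 1)) (at (of_int k))"
      unfolding has_field_derivative_iff cosk sink by simp
    moreover have "(h \<longlongrightarrow> h (of_int k)) (at (of_int k))"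
      using holomorphic_on_imp_continuous_on[OF assms(3)] assms(1,2)
      by (simp add: continuous_on_eq_continuous_at isCont_def)
    ultimately have "((\<lambda>s. h s / (sin (of_real pi * s) / (s - of_int k))) \<longlongrightarrow>
        h (of_int k) / (of_real pi * (if even k then 1 else - 1))) (at (of_int k))"
      by (intro tendsto_divide) auto
    then show "((\<lambda>s. h s / sin (of_real pi * s) * (s - of_int k)) \<longlongrightarrow>
        h (of_int k) / (of_real pi * (if even k then 1 else - 1))) (at (of_int k))"
      by simp
  qed
qed

text \<open>Residue theorem: the rectangle encloses exactly the poles -1, 0, ..., n. Its left side
  separates -2 from -1 and its right side runs through a half-integer. The sign (-1)^k of the
  residue at k turns z^k into (-z)^k and yields the minus sign at the pole -1.\<close>

lemma power_series_contour_expansion: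
  fixes c :: "complex \<Rightarrow> complex" and z :: complex
  assumes c: "c holomorphic_on {s. x1 < Re s}" and x: "x1 < x0" "- 2 < x0" "x0 < - 1"
    and z: "z \<noteq> 0" and T: "T > 0"
  shows "contour_integral (rectpath (Complex x0 (- T)) (Complex (real n + 1 / 2) T))
           (\<lambda>s. of_real pi * c s * exp (s * Ln z) / sin (of_real pi * s)) =
         2 * pi * \<i> * ((\<Sum>k\<le>n. c (of_nat k) * (- z) ^ k) - c (- 1) / z)"
proof -
  define a1 where "a1 = Complex x0 (- T)"
  define a3 where "a3 = Complex (real n + 1 / 2) T"
  define h where "h = (\<lambda>s. of_real pi * c s * exp (s * Ln z))"
  define f where "f = (\<lambda>s. h s / sin (of_real pi * s))"
  \<comment> \<open>A convex strip around the rectangle that contains no integers besides the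
    enclosed ones.\<close>
  define U where "U = {s. max x1 (- 2) < Re s} \<inter> {s. Re s < real n + 1}"
  define pts where "pts = insert (- 1) (of_nat ` {..n} :: complex set)"
  have U: "open U" "convex U"
    unfolding U_def
    by (intro open_Int open_halfspace_Re_gt open_halfspace_Re_lt,
        intro convex_Int convex_halfspace_Re_gt convex_halfspace_Re_lt)
  have ptsU: "pts \<subseteq> U" using x by (auto simp: pts_def U_def)
  have pts_box: "p \<in> box a1 a3" if "p \<in> pts" for p
    using that x T by (auto simp: pts_def in_box_complex_iff a1_def a3_def)
  have cbox: "cbox a1 a3 \<subseteq> U"
    using x by (auto simp: in_cbox_complex_iff a1_def a3_def U_def)
  have ords: "Re a1 \<le> Re a3" "Im a1 \<le> Im a3" using x T by (auto simp: a1_def a3_def)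
  have h: "h holomorphic_on U"
    unfolding h_def by (intro holomorphic_intros holomorphic_on_subset[OF c]) (auto simp: U_def)
  have sin_ne: "sin (of_real pi * s) \<noteq> 0" if s: "s \<in> U - pts" for s
  proof
    assume "sin (of_real pi * s) = 0"
    then obtain k :: int where "of_real pi * s = of_real (of_int k * pi)" unfolding sin_eq_0 by blast
    then have k: "s = of_int k" by (simp add: mult.commute)
    then have "of_int k > (-2 :: real)" "of_int k < real n + 1" using s by (auto simp: U_def)
    then have "k = -1 \<or> (0 \<le> k \<and> nat k \<le> n)" by linarith
    then have "s \<in> pts"
      by (auto simp: pts_def k intro!: image_eqI[of _ _ "nat k"])
    then show False using s by simp
  qed
  have f: "f holomorphic_on U - pts"
    unfolding f_def using sin_ne by (intro holomorphic_intros holomorphic_on_subset[OF h]) auto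
  have path: "path_image (rectpath a1 a3) \<subseteq> U - pts"
    using path_image_rectpath_subset_cbox[OF ords] path_image_rectpath_inter_box[OF ords] cbox pts_box
    by blast
  have res: "residue f (of_int k) = c (of_int k) * exp (of_int k * Ln z) * (if even k then 1 else - 1)"
    if "of_int k \<in> U" for k
    unfolding f_def using residue_divide_sin_pi[OF U(1) that h] by (simp add: h_def)
  have res_nat: "residue f (of_nat k) = c (of_nat k) * (- z) ^ k" if "k \<le> n" for k
  proof -
    have "residue f (of_int (int k)) = c (of_int (int k)) * exp (of_int (int k) * Ln z) * (if even (int k) then 1 else - 1)"
      using ptsU that by (intro res) (auto simp: pts_def)
    also have "exp (of_int (int k) * Ln z) = z ^ k"
      using z by (simp add: exp_of_nat_mult)
    finally show ?thesis by (simp add: power_minus[of z k])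
  qed
  have res_m1: "residue f (- 1) = - c (- 1) / z"
    using res[of "-1"] ptsU z by (simp add: pts_def exp_minus divide_inverse)
  have "contour_integral (rectpath a1 a3) f = 2 * pi * \<i> * (\<Sum>p\<in>pts. winding_number (rectpath a1 a3) p * residue f p)"
  proof (rule Residue_theorem[OF U(1) _ _ f _ _ path])
    show "connected U" using U(2) by (rule convex_connected)
    show "\<forall>s. s \<notin> U \<longrightarrow> winding_number (rectpath a1 a3) s = 0"
      using cbox by (auto intro!: winding_number_rectpath_outside[OF ords])
  qed (auto simp: pts_def)
  also have "(\<Sum>p\<in>pts. winding_number (rectpath a1 a3) p * residue f p) = (\<Sum>p\<in>pts. residue f p)"
    using pts_box by (intro sum.cong) (auto simp: winding_number_rectpath)
  also have "\<dots> = residue f (- 1) + (\<Sum>p\<in>of_nat ` {..n}. residue f p)"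
  proof -
    have "- 1 \<noteq> (of_nat k :: complex)" for k
    proof
      assume "- 1 = (of_nat k :: complex)"
      then have "Re (- 1) = Re (of_nat k)" by metis
      then show False by simp
    qed
    then show ?thesis unfolding pts_def by (intro sum.insert) auto
  qed
  also have "(\<Sum>p\<in>of_nat ` {..n}. residue f p) = (\<Sum>k\<le>n. residue f (of_nat k))"
    by (subst sum.reindex) (auto simp: inj_on_def)
  also have "\<dots> = (\<Sum>k\<le>n. c (of_nat k) * (- z) ^ k)"
    using res_nat by (intro sum.cong) auto
  finally show ?thesis
    unfolding res_m1 by (simp add: a1_def a3_def f_def h_def)
qed

text \<open>As the rectangle grows, first in height and then to the right, the horizontal sides
  vanish, the right side vanishes by \<open>decay\<close>, and the left side contributes a multiple
  of |z| to the power \<open>x0\<close>. The function \<open>\<rho>\<close> majorizes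
  \<open>c\<close> on the real axis; it must be locally bounded for the horizontal sides and decay
  faster than any geometric sequence along half-integers.\<close>

theorem alternating_power_series_remainder:
  fixes c :: "complex \<Rightarrow> complex" and \<rho> :: "real \<Rightarrow> real"
  assumes c: "c holomorphic_on {s. x1 < Re s}" and x: "x1 < x0" "- 2 < x0" "x0 < - 1"
    and \<theta>: "\<theta> < pi / 2" and C: "C > 0"
    and bound: "\<And>x y. x0 \<le> x \<Longrightarrow> norm (c (Complex x y)) \<le> \<rho> x * C * exp (\<theta> * \<bar>y\<bar>)"
    and locbound: "\<And>X. \<exists>B. \<forall>x. x0 \<le> x \<longrightarrow> x \<le> X \<longrightarrow> \<rho> x \<le> B"
    and decay: "\<And>r. r > 0 \<Longrightarrow> (\<lambda>n. \<rho> (real n + 1 / 2) * r powr (real n + 1 / 2)) \<longlonglongrightarrow> 0"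
    and summ: "\<And>z. summable (\<lambda>n. c (of_nat n) * z ^ n)"
  obtains L where "\<And>z. Re z > 0 \<Longrightarrow>
    norm ((\<Sum>n. c (of_nat n) * (- z) ^ n) - c (- 1) / z) \<le> L * norm z powr x0"
proof -
  have "pi / 2 - \<theta> > 0" using \<theta> by simp
  then obtain K where K: "K > 0" "\<And>y. exp (- (pi / 2 - \<theta>) * \<bar>y\<bar>) \<le> K / (1 + y\<^sup>2)"
    using exp_neg_le_inverse_quadratic by blast
  define M where "M = pi * C * K"
  define \<kappa> where "\<kappa> = \<bar>sin (pi * x0)\<bar> / 2"
  have M: "M > 0" using C K by (simp add: M_def)
  \<comment> \<open>The point pi (x0 + 2) lies in (0, pi), so the left side avoids the zeros of the
    sine.\<close>
  have \<kappa>: "\<kappa> > 0"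
  proof -
    have "sin (pi * (x0 + 2)) > 0" using x by (intro sin_gt_zero) auto
    also have "pi * (x0 + 2) = pi * x0 + 2 * pi" by (simp add: algebra_simps)
    finally show ?thesis by (simp add: \<kappa>_def)
  qed
  have \<rho>: "\<rho> x \<ge> 0" if "x0 \<le> x" for x
    using order_trans[OF norm_ge_zero bound[OF that, of 0]] C by (simp add: zero_le_mult_iff)
  define L where "L = M / \<kappa> * \<rho> x0"
  have "norm ((\<Sum>n. c (of_nat n) * (- z) ^ n) - c (- 1) / z) \<le> L * norm z powr x0"
    if z: "Re z > 0" for z
  proof -
    have z0: "z \<noteq> 0" using z by auto
    define f where "f = (\<lambda>s. of_real pi * c s * exp (s * Ln z) / sin (of_real pi * s))"
    \<comment> \<open>The rates \<open>\<theta>\<close> from \<open>c\<close>, pi/2 from exp (s Ln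
      z) with |Im (Ln z)| <= pi/2, and -pi from the sine add up to a negative number. The constant
      \<open>k\<close> will be \<open>\<kappa>\<close> on the left side, 1/2 on the right side and
      1/4 on the horizontal sides.\<close>
    have norm_f: "norm (f (Complex x y)) \<le> M / k * \<rho> x * norm z powr x / (1 + y\<^sup>2)"
      if xx: "x0 \<le> x" and k: "k > 0" and sin: "norm (sin (of_real pi * Complex x y)) \<ge> k * exp (pi * \<bar>y\<bar>)"
      for x y k
    proof -
      have "norm (exp (Complex x y * Ln z)) = norm z powr x * exp (- y * Im (Ln z))"
        using z0 by (simp add: powr_def flip: exp_add)
      also have "\<dots> \<le> norm z powr x * exp (pi / 2 * \<bar>y\<bar>)"
      proof -
        have "\<bar>Im (Ln z)\<bar> \<le> pi / 2" using Re_Ln_pos_lt[OF z0] z by simp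
        then have "\<bar>y\<bar> * \<bar>Im (Ln z)\<bar> \<le> \<bar>y\<bar> * (pi / 2)" by (intro mult_left_mono) auto
        moreover have "- y * Im (Ln z) \<le> \<bar>y\<bar> * \<bar>Im (Ln z)\<bar>"
          by (metis abs_ge_self abs_minus_cancel abs_mult)
        ultimately show ?thesis by (intro mult_left_mono) (auto simp: mult.commute)
      qed
      finally have e: "norm (exp (Complex x y * Ln z)) \<le> norm z powr x * exp (pi / 2 * \<bar>y\<bar>)" .
      have "norm (f (Complex x y)) = pi * norm (c (Complex x y)) * norm (exp (Complex x y * Ln z)) / norm (sin (of_real pi * Complex x y))"
        by (simp add: f_def norm_mult norm_divide)
      also have "\<dots> \<le> pi * (\<rho> x * C * exp (\<theta> * \<bar>y\<bar>)) * (norm z powr x * exp (pi / 2 * \<bar>y\<bar>)) / (k * exp (pi * \<bar>y\<bar>))"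
        using bound[OF xx, of y] e sin k \<rho>[OF xx] C
        by (intro frac_le mult_mono) auto
      also have "\<dots> = pi * C / k * \<rho> x * norm z powr x * (exp (\<theta> * \<bar>y\<bar>) * exp (pi / 2 * \<bar>y\<bar>) / exp (pi * \<bar>y\<bar>))"
        by (simp add: mult_ac)
      also have "exp (\<theta> * \<bar>y\<bar>) * exp (pi / 2 * \<bar>y\<bar>) / exp (pi * \<bar>y\<bar>) = exp (- (pi / 2 - \<theta>) * \<bar>y\<bar>)"
        unfolding exp_add[symmetric] exp_diff[symmetric] by (simp add: algebra_simps)
      also have "pi * C / k * \<rho> x * norm z powr x * exp (- (pi / 2 - \<theta>) * \<bar>y\<bar>) \<le>
          pi * C / k * \<rho> x * norm z powr x * (K / (1 + y\<^sup>2))"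
        using C k \<rho>[OF xx] by (intro mult_left_mono K) auto
      finally show ?thesis by (simp add: M_def mult_ac)
    qed
    have sin_vert: "norm (sin (of_real pi * Complex x y)) \<ge> \<bar>sin (pi * x)\<bar> / 2 * exp (pi * \<bar>y\<bar>)" for x y
      using norm_sin_ge_of_Re[of "of_real pi * Complex x y"] by (simp add: abs_mult mult_ac)
    have sin_hor: "norm (sin (of_real pi * Complex x y)) \<ge> 1 / 4 * exp (pi * \<bar>y\<bar>)" if "\<bar>y\<bar> \<ge> 1" for x y
    proof -
      have "1 * 1 \<le> pi * \<bar>y\<bar>" using that pi_ge_two by (intro mult_mono) auto
      then show ?thesis
        using norm_sin_ge_of_Im[of "of_real pi * Complex x y"] by (simp add: abs_mult)
    qed
    define S where "S = (\<lambda>n. (\<Sum>k\<le>n. c (of_nat k) * (- z) ^ k) - c (- 1) / z)"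
    define R where "R = (\<lambda>n. M / (1 / 2) * \<rho> (real n + 1 / 2) * norm z powr (real n + 1 / 2))"
    have S_bound: "norm (S n) \<le> (L * norm z powr x0 + R n) / 2" for n
    proof -
      define X where "X = real n + 1 / 2"
      have X: "x0 < X" using x by (simp add: X_def)
      obtain B where B: "\<And>x. x0 \<le> x \<Longrightarrow> x \<le> X \<Longrightarrow> \<rho> x \<le> B" using locbound by blast
      \<comment> \<open>The power of |z| is monotone in the exponent, in a direction that depends on
        whether |z| exceeds 1; the sum of the end values covers both cases.\<close>
      define Z where "Z = norm z powr x0 + norm z powr X"
      have Z: "norm z powr x \<le> Z" if "x0 \<le> x" "x \<le> X" for x
      proof (cases "norm z \<ge> 1")
        case True
        then have "norm z powr x \<le> norm z powr X" using that by (intro powr_mono) auto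
        then show ?thesis by (simp add: Z_def add_increasing)
      next
        case False
        then have "norm z powr x \<le> norm z powr x0" using that z0 by (intro powr_mono') auto
        then show ?thesis by (simp add: Z_def add_increasing2)
      qed
      define D where "D = M / (1 / 4) * B * Z"
      have "B \<ge> 0" using B[of x0] \<rho>[of x0] X by linarith
      moreover have "Z \<ge> 0" by (simp add: Z_def)
      ultimately have D: "D \<ge> 0" using M by (simp add: D_def)
      \<comment> \<open>The last summand, from the two horizontal sides, is the only one that
        depends on \<open>T\<close>.\<close>
      have T_bound: "2 * pi * norm (S n) \<le> L * norm z powr x0 * pi + R n * pi + 2 * (D / (1 + T\<^sup>2) * (X - x0))"
        if T: "T \<ge> 1" for T
      proof -
        let ?p1 = "Complex x0 (- T)" and ?p2 = "Complex X (- T)" and ?p3 = "Complex X T" and ?p4 = "Complex x0 T"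
        have X_half: "\<bar>sin (pi * X)\<bar> = 1"
        proof -
          have "sin (pi * X) = cos (pi * real n)"
            by (simp add: X_def distrib_left sin_add)
          then show ?thesis by (simp add: power_abs)
        qed
        have vleft: "norm (f (Complex x0 y)) \<le> (L * norm z powr x0) / (1 + y\<^sup>2)" for y
          using norm_f[of x0 \<kappa> y] \<kappa> sin_vert[of x0 y] by (simp add: \<kappa>_def L_def)
        have vright: "norm (f (Complex X y)) \<le> R n / (1 + y\<^sup>2)" for y
          using norm_f[of X "1 / 2" y] X sin_vert[of X y] by (simp add: X_half R_def flip: X_def)
        have hor: "norm (f (Complex t y)) \<le> D / (1 + T\<^sup>2)" if t: "x0 \<le> t" "t \<le> X" and y: "\<bar>y\<bar> = T" for t y
        proof -
          have "norm (f (Complex t y)) \<le> M / (1 / 4) * \<rho> t * norm z powr t / (1 + y\<^sup>2)"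
            using t y T sin_hor[of y t] by (intro norm_f) auto
          also have "\<dots> \<le> M / (1 / 4) * B * Z / (1 + y\<^sup>2)"
            using t M \<rho>[OF t(1)] B[OF t] Z[OF t]
            by (intro divide_right_mono mult_mono) (auto intro: order_trans)
          also have "y\<^sup>2 = T\<^sup>2" using y by (metis power2_abs)
          finally show ?thesis by (simp add: D_def)
        qed
        have cont: "continuous_on {s. x0 \<le> Re s \<and> sin (of_real pi * s) \<noteq> 0} f"
          unfolding f_def
          by (intro continuous_intros holomorphic_on_imp_continuous_on holomorphic_on_subset[OF c])
             (use x in auto)
        have ne: "sin (of_real pi * s) \<noteq> 0" if "Re s = x0 \<or> Re s = X \<or> \<bar>Im s\<bar> = T" for s
        proof
          assume s0: "sin (of_real pi * s) = 0"
          from that consider "Re s = x0" | "Re s = X" | "\<bar>Im s\<bar> = T" by blast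
          then show False
          proof cases
            case 1
            have "\<kappa> * exp (pi * \<bar>Im s\<bar>) > 0" using \<kappa> by simp
            moreover have "s = Complex x0 (Im s)" using 1 by (simp add: complex_eq_iff)
            then have "sin (of_real pi * Complex x0 (Im s)) = 0" using s0 by metis
            ultimately show ?thesis using sin_vert[of x0 "Im s"] by (simp add: \<kappa>_def)
          next
            case 2
            then have "s = Complex X (Im s)" by (simp add: complex_eq_iff)
            then have "sin (of_real pi * Complex X (Im s)) = 0" using s0 by metis
            then show ?thesis using sin_vert[of X "Im s"] X_half by simp
          next
            case 3
            then show ?thesis using sin_hor[of "Im s" "Re s"] s0 T by simp
          qed
        qed
        have seg: "closed_segment ?p1 ?p2 \<subseteq> {s. x0 \<le> Re s \<and> Re s \<le> X \<and> Im s = - T}"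
                  "closed_segment ?p2 ?p3 \<subseteq> {s. x0 \<le> Re s \<and> Re s = X}"
                  "closed_segment ?p3 ?p4 \<subseteq> {s. x0 \<le> Re s \<and> Re s \<le> X \<and> Im s = T}"
                  "closed_segment ?p1 ?p4 \<subseteq> {s. x0 \<le> Re s \<and> Re s = x0}"
          using X by (auto simp: closed_segment_same_Re closed_segment_same_Im closed_segment_eq_real_ivl)
        have co: "continuous_on (closed_segment ?p1 ?p2) f" "continuous_on (closed_segment ?p2 ?p3) f"
                 "continuous_on (closed_segment ?p3 ?p4) f" "continuous_on (closed_segment ?p1 ?p4) f"
          using seg ne T by (auto intro!: continuous_on_subset[OF cont])
        have ci: "f contour_integrable_on linepath ?p1 ?p2" "f contour_integrable_on linepath ?p2 ?p3"
                 "f contour_integrable_on linepath ?p3 ?p4" "f contour_integrable_on linepath ?p4 ?p1"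
          using co by (auto intro!: contour_integrable_continuous_linepath simp: closed_segment_commute[of ?p4])
        have norm_tri: "norm (p + q + r - w) \<le> norm p + norm q + norm r + norm w" for p q r w :: complex
          using norm_triangle_ineq4[of "p + q + r" w] norm_triangle_ineq[of "p + q" r] norm_triangle_ineq[of p q]
          by linarith
        have "2 * pi * \<i> * S n = contour_integral (rectpath ?p1 ?p3) f"
          using power_series_contour_expansion[OF c x z0, of T n] T by (simp add: S_def f_def X_def)
        \<comment> \<open>The left side is reversed to run upwards, as
          \<open>norm_contour_integral_vertical_le\<close> expects.\<close>
        also have "\<dots> = contour_integral (linepath ?p1 ?p2) f + contour_integral (linepath ?p2 ?p3) f
             + contour_integral (linepath ?p3 ?p4) f - contour_integral (linepath ?p1 ?p4) f"
        proof -
          have "contour_integral (linepath ?p4 ?p1) f = - contour_integral (linepath ?p1 ?p4) f"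
            using contour_integral_reverse_linepath[OF co(4)] by simp
          then show ?thesis using ci by (simp add: rectpath_def Let_def contour_integrable_joinI add.assoc)
        qed
        finally have "norm (2 * pi * \<i> * S n) \<le> norm (contour_integral (linepath ?p1 ?p2) f) + norm (contour_integral (linepath ?p2 ?p3) f)
             + norm (contour_integral (linepath ?p3 ?p4) f) + norm (contour_integral (linepath ?p1 ?p4) f)"
          by (simp only: norm_tri)
        moreover have "norm (2 * pi * \<i> * S n) = 2 * pi * norm (S n)"
          by (simp add: norm_mult)
        moreover have hor': "norm (f s) \<le> D / (1 + T\<^sup>2)"
          if "x0 \<le> Re s" "Re s \<le> X" "\<bar>Im s\<bar> = T" for s
          using hor[of "Re s" "Im s"] that by simp
        have "norm (contour_integral (linepath ?p1 ?p2) f) \<le> D / (1 + T\<^sup>2) * (X - x0)"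
        proof -
          have "?p2 - ?p1 = of_real (X - x0)" by (simp add: complex_eq_iff)
          then have "norm (?p2 - ?p1) = X - x0" using X by (simp only: norm_of_real)
          moreover have "norm (contour_integral (linepath ?p1 ?p2) f) \<le> D / (1 + T\<^sup>2) * norm (?p2 - ?p1)"
            using seg(1) T D by (intro contour_integral_bound_linepath ci hor') auto
          ultimately show ?thesis by metis
        qed
        moreover have "norm (contour_integral (linepath ?p3 ?p4) f) \<le> D / (1 + T\<^sup>2) * (X - x0)"
        proof -
          have "?p4 - ?p3 = of_real (x0 - X)" by (simp add: complex_eq_iff)
          then have "norm (?p4 - ?p3) = X - x0" using X by (simp only: norm_of_real)
          moreover have "norm (contour_integral (linepath ?p3 ?p4) f) \<le> D / (1 + T\<^sup>2) * norm (?p4 - ?p3)"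
            using seg(3) T D by (intro contour_integral_bound_linepath ci hor') auto
          ultimately show ?thesis by metis
        qed
        moreover have "norm (contour_integral (linepath ?p2 ?p3) f) \<le> R n * pi"
          using T by (intro norm_contour_integral_vertical_le co vright) auto
        moreover have "norm (contour_integral (linepath ?p1 ?p4) f) \<le> L * norm z powr x0 * pi"
          using T by (intro norm_contour_integral_vertical_le co vleft) auto
        ultimately show ?thesis by linarith
      qed
      have "2 * pi * norm (S n) \<le> L * norm z powr x0 * pi + R n * pi"
      proof (rule tendsto_lowerbound)
        have "((\<lambda>T. D / (1 + T\<^sup>2) * (X - x0)) \<longlongrightarrow> 0) at_top"
          by real_asymp
        then have "((\<lambda>T. L * norm z powr x0 * pi + R n * pi + 2 * (D / (1 + T\<^sup>2) * (X - x0))) \<longlongrightarrow>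
           L * norm z powr x0 * pi + R n * pi + 2 * 0) at_top"
          by (intro tendsto_intros)
        then show "((\<lambda>T. L * norm z powr x0 * pi + R n * pi + 2 * (D / (1 + T\<^sup>2) * (X - x0))) \<longlongrightarrow>
           L * norm z powr x0 * pi + R n * pi) at_top" by simp
        show "\<forall>\<^sub>F T in at_top. 2 * pi * norm (S n) \<le> L * norm z powr x0 * pi + R n * pi + 2 * (D / (1 + T\<^sup>2) * (X - x0))"
          using eventually_ge_at_top[of 1] by eventually_elim (rule T_bound)
      qed simp
      then have "pi * (2 * norm (S n)) \<le> pi * (L * norm z powr x0 + R n)"
        by (simp add: algebra_simps)
      then show ?thesis by simp
    qed
    have "(\<lambda>n. norm (S n)) \<longlonglongrightarrow> norm ((\<Sum>n. c (of_nat n) * (- z) ^ n) - c (- 1) / z)"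
      unfolding S_def by (intro tendsto_intros summable_LIMSEQ' summ)
    moreover have "(\<lambda>n. (L * norm z powr x0 + R n) / 2) \<longlonglongrightarrow> (L * norm z powr x0 + 0) / 2"
    proof (intro tendsto_intros)
      have "(\<lambda>n. M / (1 / 2) * (\<rho> (real n + 1 / 2) * norm z powr (real n + 1 / 2))) \<longlonglongrightarrow> M / (1 / 2) * 0"
        using z0 by (intro tendsto_intros decay) auto
      then show "R \<longlonglongrightarrow> 0" by (simp add: R_def mult_ac)
    qed auto
    ultimately have "norm ((\<Sum>n. c (of_nat n) * (- z) ^ n) - c (- 1) / z) \<le> (L * norm z powr x0 + 0) / 2"
      using S_bound by (intro LIMSEQ_le) auto
    also have "\<dots> \<le> L * norm z powr x0"
    proof -
      have "L * norm z powr x0 \<ge> 0" using M \<kappa> \<rho>[of x0] by (simp add: L_def)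
      moreover have "(v + 0) / 2 \<le> v" if "v \<ge> 0" for v :: real using that by simp
      ultimately show ?thesis by blast
    qed
    finally show ?thesis .
  qed
  then show ?thesis using that by blast
qed

section \<open>Extrapolation of concave functions\<close>

text \<open>Beyond \<open>q\<close>, the graph of a concave function lies below the line through its
  points at \<open>p\<close> and \<open>q\<close>; this is concavity at \<open>q\<close>, a convex
  combination of \<open>p\<close> and \<open>x\<close>.\<close>

lemma concave_extrapolate_right:
  fixes f :: "real \<Rightarrow> real"
  assumes "concave_on S f" "p \<in> S" "x \<in> S" "p < q" "q \<le> x"
  shows "f x \<le> f q + (x - q) * ((f q - f p) / (q - p))"
proof -
  define t where "t = (q - p) / (x - p)"
  have xp: "x - p > 0" using assms by simp
  have "concave_on S f \<Longrightarrow> - f ((1 - t) *\<^sub>R p + t *\<^sub>R x) \<le> (1 - t) * (- f p) + t * (- f x)"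
    using assms xp unfolding concave_on_def
    by (intro convex_onD[of S "\<lambda>x. - f x"]) (auto simp: t_def)
  moreover have "(1 - t) *\<^sub>R p + t *\<^sub>R x = p + t * (x - p)"
    by (simp add: algebra_simps)
  moreover have "p + t * (x - p) = q" using xp by (simp add: t_def)
  ultimately have "f p + t * (f x - f p) \<le> f q"
    using assms(1) by (simp add: algebra_simps)
  then have "t * (f x - f p) * (x - p) \<le> (f q - f p) * (x - p)"
    using xp by (intro mult_right_mono) auto
  also have "t * (f x - f p) * (x - p) = (q - p) * (f x - f p)"
    using xp by (simp add: t_def)
  finally have "(f x - f p) \<le> (f q - f p) * (x - p) / (q - p)"
    using assms by (simp add: field_simps)
  also have "\<dots> = (f q - f p) + (x - q) * ((f q - f p) / (q - p))"
    using assms by (simp add: field_simps)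
  finally show ?thesis by simp
qed

text \<open>Exponentiates the extrapolation inequality for a log-concave function.\<close>

lemma le_mult_powr_of_ln_le:
  fixes x p q :: real
  assumes "ln x \<le> ln q + u * ((ln q - ln p) / d)" "p > 0" "q > 0" "x > 0"
  shows "x \<le> q * (q / p) powr (u / d)"
proof -
  have "x = exp (ln x)" using assms by simp
  also have "\<dots> \<le> exp (ln q + u * ((ln q - ln p) / d))"
    by (subst exp_le_cancel_iff) (rule assms(1))
  also have "\<dots> = exp (ln q) * exp (u / d * (ln q - ln p))" by (simp add: exp_add)
  also have "\<dots> = q * (q / p) powr (u / d)"
    using assms by (simp add: powr_def ln_divide_pos)
  finally show ?thesis .
qed

text \<open>The previous extrapolation applied to the reflected function f (-x).\<close>

lemma concave_extrapolate_left:
  fixes f :: "real \<Rightarrow> real"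
  assumes "concave_on S f" "x \<in> S" "q \<in> S" "x \<le> p" "p < q"
  shows "f x \<le> f p - (p - x) * ((f q - f p) / (q - p))"
proof -
  have "convex_on (uminus ` S) (\<lambda>x. - f (- x))"
  proof -
    have c: "convex_on S (\<lambda>x. - f x)" using assms(1) by (simp add: concave_on_def)
    show ?thesis
    proof (rule convex_onI)
      fix t x y :: real
      assume "0 < t" "t < 1" "x \<in> uminus ` S" "y \<in> uminus ` S"
      then show "- f (- ((1 - t) *\<^sub>R x + t *\<^sub>R y)) \<le> (1 - t) * - f (- x) + t * - f (- y)"
        using convex_onD[OF c, of t "-x" "-y"] by (force simp: algebra_simps)
    qed (use c in \<open>auto simp: convex_on_def intro!: convex_negations\<close>)
  qed
  then have "concave_on (uminus ` S) (\<lambda>x. f (- x))" by (simp add: concave_on_def)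
  from concave_extrapolate_right[OF this, of "-q" "-x" "-p"] assms
  have "f x \<le> f p + (p - x) * ((f p - f q) / (q - p))"
    by (simp add: algebra_simps)
  also have "\<dots> = f p - (p - x) * ((f q - f p) / (q - p))"
    by (metis add_uminus_conv_diff minus_diff_eq minus_divide_left mult_minus_right)
  finally show ?thesis .
qed

section \<open>The approximants of the interpolating function\<close>

text \<open>With \<open>A = 1 + a l\<close> and \<open>b = a m\<close>, the ratio of consecutive Kilbas--Saigo coefficients
  is \<open>step n\<close>, and the hypothesis \<open>l > m - 1 / a\<close> reads \<open>b < A\<close>.\<close>
locale kilbas_saigo_setup =
  fixes a A b :: real
  assumes a: "0 < a" "a < 1" and b: "0 < b" "b < A"
begin

definition step :: "real \<Rightarrow> real" where
  "step x = gamma_quot a (A + b * x)"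

definition cstep :: "complex \<Rightarrow> complex" where
  "cstep s = gamma_quot a (of_real A + of_real b * s)"

definition coeff :: "nat \<Rightarrow> real" where
  "coeff n = (\<Prod>k<n. step (real k))"

text \<open>Analogue of Gauss's product for the Gamma function, adapted to the functional equation
  c(x + 1) = step x c(x) with c(0) = 1.\<close>

definition approx :: "nat \<Rightarrow> real \<Rightarrow> real" where
  "approx N x = step N powr x * (\<Prod>k<N. step (real k) / step (x + real k))"

text \<open>The complex version of \<open>approx\<close>; writing the power of \<open>step N\<close>
  as an exponential makes that factor entire in \<open>s\<close>.\<close>

definition capprox :: "nat \<Rightarrow> complex \<Rightarrow> complex" where
  "capprox N s = exp (s * of_real (ln (step N))) * (\<Prod>k<N. of_real (step (real k)) / cstep (s + of_nat k))"

text \<open>Here the arguments of the Gamma quotient have positive real part. As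
  \<open>b < A\<close>, a strip to the left of -1 belongs to it, which is where an exponent above 1
  comes from.\<close>

definition dom :: "complex set" where
  "dom = {s. - A / b < Re s}"

lemma dom_iff: "s \<in> dom \<longleftrightarrow> A + b * Re s > 0"
  using b by (auto simp: dom_def field_simps)

lemma open_dom: "open dom"
  unfolding dom_def by (simp add: open_halfspace_Re_gt)

lemma arg_pos: "A + b * x > 0 \<Longrightarrow> A + b * (x + real k) > 0"
proof -
  assume "A + b * x > 0"
  moreover have "b * real k \<ge> 0" using b by simp
  ultimately show ?thesis by (simp add: distrib_left)
qed

lemma step_pos: "A + b * x > 0 \<Longrightarrow> step x > 0"
  using a by (simp add: step_def gamma_quot_pos)

lemma step_nat_pos: "step (real k) > 0"
  using b by (intro step_pos add_pos_nonneg) auto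

lemma coeff_pos: "coeff n > 0"
  by (simp add: coeff_def step_nat_pos prod_pos)

lemma coeff_Suc: "coeff (Suc n) = coeff n * step n"
  by (simp add: coeff_def)

lemma approx_pos: "A + b * x > 0 \<Longrightarrow> approx N x > 0"
  using step_nat_pos[of N] step_nat_pos step_pos[OF arg_pos[of x]] unfolding approx_def
  by (intro mult_pos_pos prod_pos divide_pos_pos) (auto simp: less_imp_neq[symmetric])

lemma cstep_of_real: "cstep (of_real x) = of_real (step x)"
  by (simp add: cstep_def step_def flip: gamma_quot_of_real)

lemma capprox_of_real: "capprox N (of_real x) = of_real (approx N x)"
proof -
  have "cstep (of_real x + of_nat k) = of_real (step (x + k))" for k
    using cstep_of_real[of "x + k"] by simp
  moreover have "exp (complex_of_real x * of_real (ln (step N))) = of_real (step N powr x)"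
    using step_nat_pos[of N] by (simp add: powr_def flip: exp_of_real)
  ultimately show ?thesis by (simp add: capprox_def approx_def)
qed

lemma step_tendsto_0: "(\<lambda>n. step (real n)) \<longlonglongrightarrow> 0"
proof -
  have "filterlim (\<lambda>n. A + b * real n) at_top sequentially"
    using b by real_asymp
  from filterlim_compose[OF gamma_quot_tendsto_0[OF a] this] show ?thesis
    by (simp add: step_def)
qed

lemma step_ratio_tendsto: "(\<lambda>n. step (real n) / step (real n + d)) \<longlonglongrightarrow> 1"
proof -
  have "filterlim (\<lambda>n. A + b * real n) at_top sequentially"
    using b by real_asymp
  from filterlim_compose[OF gamma_quot_shift_tendsto[OF a, of "b * d"] this] show ?thesis
    by (simp add: step_def algebra_simps)
qed

lemma approx_0: "approx N 0 = 1"
  using step_nat_pos[of N] step_nat_pos by (simp add: approx_def less_imp_neq[symmetric])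

text \<open>Shifting \<open>x\<close> by 1 shifts the index of the denominators, so all but two of
  them cancel. The defect \<open>step N / step (x + N)\<close> tends to 1 at the points where the
  limit is computed below.\<close>

lemma approx_plus_1:
  assumes "A + b * x > 0"
  shows "approx N (x + 1) = approx N x * (step x * (step N / step (x + N)))"
proof -
  have pos: "step (x + real k) > 0" for k
    using assms arg_pos by (intro step_pos) auto
  have "(\<Prod>k<N. step (real k) / step (x + 1 + real k)) * step (x + N) = step x * (\<Prod>k<N. step (real k) / step (x + real k))"
  proof (induction N)
    case (Suc N)
    have "step (x + 1 + real N) = step (x + real (Suc N))" by (simp add: algebra_simps)
    then have "(\<Prod>k<Suc N. step (real k) / step (x + 1 + real k)) * step (x + Suc N)
        = ((\<Prod>k<N. step (real k) / step (x + 1 + real k)) * step (x + N)) * step N / step (x + N)"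
      using pos[of N] pos[of "Suc N"] by simp
    then show ?case unfolding Suc by simp
  qed simp
  then have "(\<Prod>k<N. step (real k) / step (x + 1 + real k)) = step x * (\<Prod>k<N. step (real k) / step (x + real k)) / step (x + N)"
    using pos[of N] by (simp add: field_simps)
  then show ?thesis
    using step_nat_pos[of N] by (simp add: approx_def powr_add)
qed

lemma approx_1: "approx N 1 = step 0"
  using approx_plus_1[of 0 N] b step_nat_pos[of N] by (simp add: approx_0)

lemma approx_nat_tendsto: "(\<lambda>N. approx N (real n)) \<longlonglongrightarrow> coeff n"
proof (induction n)
  case 0
  then show ?case by (simp add: approx_0 coeff_def)
next
  case (Suc n)
  have "A + b * real n > 0" using b by (intro add_pos_nonneg) auto
  then have eq: "approx N (real (Suc n)) = approx N n * (step n * (step N / step (N + real n)))" for N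
    using approx_plus_1[of "real n" N] by (simp add: add.commute)
  have "(\<lambda>N. approx N (real (Suc n))) \<longlonglongrightarrow> coeff n * (step n * 1)"
    unfolding eq by (intro tendsto_intros Suc step_ratio_tendsto)
  then show ?case by (simp add: coeff_Suc)
qed

lemma approx_minus_1_tendsto: "(\<lambda>N. approx N (- 1)) \<longlonglongrightarrow> 1 / step (- 1)"
proof -
  have p: "step (-1) > 0" using b by (intro step_pos) auto
  \<comment> \<open>The recurrence at -1 ends at \<open>approx_0\<close>. With \<open>Suc N\<close>,
    the shifted point \<open>real (Suc N) + -1\<close> is a natural number, where
    \<open>step\<close> is positive.\<close>
  have eq: "approx (Suc N) (-1) = inverse (step (-1)) / (step (Suc N) / step (real (Suc N) + -1))" for N
  proof -
    define r where "r = step (Suc N) / step (real (Suc N) + -1)"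
    have "r > 0" using step_nat_pos[of "Suc N"] step_nat_pos[of N] by (simp add: r_def)
    moreover have "approx (Suc N) (-1) * (step (-1) * r) = 1"
    proof -
      have "A + b * (-1) > 0" using b by simp
      from approx_plus_1[OF this, of "Suc N"]
      have "approx (Suc N) (-1 + 1) = approx (Suc N) (-1) * (step (-1) * r)"
        by (simp only: r_def add.commute)
      then show ?thesis by (simp add: approx_0)
    qed
    ultimately show ?thesis
      using p unfolding r_def[symmetric] by (simp add: field_simps)
  qed
  have "(\<lambda>N. inverse (step (-1)) / (step (Suc N) / step (real (Suc N) + -1))) \<longlonglongrightarrow> inverse (step (-1)) / 1"
    by (intro tendsto_intros LIMSEQ_Suc[OF step_ratio_tendsto]) auto
  then have "(\<lambda>N. approx (Suc N) (-1)) \<longlonglongrightarrow> 1 / step (-1)"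
    by (simp only: eq inverse_eq_divide div_by_1)
  then show ?thesis by (rule LIMSEQ_imp_Suc)
qed

section \<open>Log-concavity and uniform bounds for the approximants\<close>

text \<open>The logarithm is an affine function of \<open>x\<close> minus a sum of functions that
  are convex by \<open>convex_ln_gamma_quot\<close>.\<close>

lemma concave_ln_approx: "concave_on {x. A + b * x > 0} (\<lambda>x. ln (approx N x))"
proof -
  have D: "convex {x. A + b * x > 0}"
  proof -
    have "{x. A + b * x > 0} = {- A / b<..}" using b by (auto simp: field_simps)
    then show ?thesis by simp
  qed
  have conv: "convex_on {x. A + b * x > 0} (\<lambda>x. ln (step (x + real k)))" for k
  proof (rule convex_onI)
    fix t x y :: real
    assume *: "0 < t" "t < 1" "x \<in> {x. A + b * x > 0}" "y \<in> {x. A + b * x > 0}"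
    have "ln (gamma_quot a ((1 - t) *\<^sub>R (A + b * (x + k)) + t *\<^sub>R (A + b * (y + k))))
        \<le> (1 - t) * ln (gamma_quot a (A + b * (x + k))) + t * ln (gamma_quot a (A + b * (y + k)))"
      using * arg_pos by (intro convex_onD[OF convex_ln_gamma_quot[OF a(1)]]) auto
    also have "(1 - t) *\<^sub>R (A + b * (x + k)) + t *\<^sub>R (A + b * (y + k)) = A + b * (((1 - t) *\<^sub>R x + t *\<^sub>R y) + k)"
      by (simp add: algebra_simps)
    finally show "ln (step (((1 - t) *\<^sub>R x + t *\<^sub>R y) + k)) \<le> (1 - t) * ln (step (x + real k)) + t * ln (step (y + real k))"
      by (simp add: step_def)
  qed (rule D)
  have "ln (approx N x) = x * ln (step N) + (\<Sum>k<N. ln (step (real k))) - (\<Sum>k<N. ln (step (x + real k)))"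
    if "A + b * x > 0" for x
  proof -
    have pos: "step (x + real k) > 0" for k using that arg_pos by (intro step_pos) auto
    have "ln (approx N x) = ln (step N powr x) + ln (\<Prod>k<N. step (real k) / step (x + real k))"
      unfolding approx_def using step_nat_pos pos
      by (intro ln_mult_pos prod_pos) (auto simp: less_imp_neq[symmetric])
    also have "ln (\<Prod>k<N. step (real k) / step (x + real k)) = (\<Sum>k<N. ln (step (real k) / step (x + real k)))"
      using pos step_nat_pos by (intro ln_prod) (auto simp: less_imp_neq[symmetric])
    also have "\<dots> = (\<Sum>k<N. ln (step (real k)) - ln (step (x + real k)))"
      using pos step_nat_pos by (intro sum.cong refl ln_divide_pos) auto
    also have "ln (step N powr x) = x * ln (step N)"
      using step_nat_pos[of N] by (simp add: ln_powr)
    finally show ?thesis by (simp add: sum_subtractf)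
  qed
  note eq = this
  show ?thesis
    unfolding concave_on_def
  proof (rule convex_onI)
    fix t x y :: real
    assume *: "0 < t" "t < 1" "x \<in> {x. A + b * x > 0}" "y \<in> {x. A + b * x > 0}"
    define z where "z = (1 - t) *\<^sub>R x + t *\<^sub>R y"
    have z: "A + b * z > 0"
      using convexD_alt[OF D *(3,4), of t] * unfolding z_def by simp
    have "(\<Sum>k<N. ln (step (z + real k))) \<le> (1 - t) * (\<Sum>k<N. ln (step (x + real k))) + t * (\<Sum>k<N. ln (step (y + real k)))"
      unfolding z_def sum_distrib_left sum.distrib[symmetric]
      using * by (intro sum_mono convex_onD[OF conv]) auto
    then have "- ln (approx N z) \<le> (1 - t) * - ln (approx N x) + t * - ln (approx N y)"
      using * z by (simp add: eq z_def algebra_simps)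
    then show "- ln (approx N ((1 - t) *\<^sub>R x + t *\<^sub>R y)) \<le> (1 - t) * - ln (approx N x) + t * - ln (approx N y)"
      by (simp add: z_def)
  qed (rule D)
qed

text \<open>The values at 0 and 1 do not depend on \<open>N\<close>, so extrapolating to the left
  from them gives a bound free of \<open>N\<close>.\<close>

lemma approx_le_of_nonpos:
  assumes "A + b * x > 0" "x \<le> 0"
  shows "approx N x \<le> step 0 powr x"
proof -
  have "ln (approx N x) \<le> ln (approx N 0) - (0 - x) * ((ln (approx N 1) - ln (approx N 0)) / (1 - 0))"
    using assms b by (intro concave_extrapolate_left[OF concave_ln_approx]) auto
  then have "exp (ln (approx N x)) \<le> exp (x * ln (step 0))"
    by (simp add: approx_0 approx_1)
  then show ?thesis
    using approx_pos[OF assms(1), of N] step_nat_pos[of 0] by (simp add: powr_def)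
qed

lemma approx_le_extrapolate:
  assumes "A + b * p > 0" "p < q" "q \<le> x"
  shows "approx N x \<le> approx N q * (approx N q / approx N p) powr ((x - q) / (q - p))"
proof -
  have "b * p \<le> b * q" "b * q \<le> b * x" using assms b by (simp_all add: mult_left_mono)
  then have qx: "A + b * q > 0" "A + b * x > 0" using assms(1) by linarith+
  note pos = approx_pos[OF assms(1), of N] approx_pos[OF qx(1), of N] approx_pos[OF qx(2), of N]
  have "ln (approx N x) \<le> ln (approx N q) + (x - q) * ((ln (approx N q) - ln (approx N p)) / (q - p))"
    using assms(2,3) by (intro concave_extrapolate_right[OF concave_ln_approx] CollectI assms(1) qx(2))
  from le_mult_powr_of_ln_le[OF this pos] show ?thesis .
qed


lemma cstep_ne_0: "A + b * Re s > 0 \<Longrightarrow> cstep s \<noteq> 0"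
  unfolding cstep_def using a by (intro gamma_quot_ne_0) auto

lemma cstep_holomorphic: "(\<lambda>s. cstep (s + of_nat k)) holomorphic_on dom"
proof -
  have "(\<lambda>s. of_real A + of_real b * (s + of_nat k)) ` dom \<subseteq> {z. Re z > 0}"
    using arg_pos by (auto simp: dom_iff)
  moreover have "(\<lambda>s. of_real A + of_real b * (s + of_nat k)) holomorphic_on dom"
    by (intro holomorphic_intros)
  ultimately show ?thesis
    using holomorphic_on_compose_gen[OF _ gamma_quot_holomorphic[OF a(1)]]
    unfolding cstep_def o_def by blast
qed

lemma capprox_holomorphic: "capprox N holomorphic_on dom"
  unfolding capprox_def
proof (intro holomorphic_intros cstep_holomorphic)
  fix s k assume "s \<in> dom"
  then show "cstep (s + of_nat k) \<noteq> 0"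
    using arg_pos by (intro cstep_ne_0) (auto simp: dom_iff)
qed

text \<open>Separates the value at the real point, governed by log-concavity, from the vertical
  growth, which has the form bounded in \<open>prod_gamma_quot_ratio_bound\<close> with u = A + b
  x.\<close>

lemma norm_capprox:
  assumes "A + b * x > 0"
  shows "norm (capprox N (Complex x y)) = approx N x *
    (\<Prod>k<N. gamma_quot a ((A + b * x) + b * real k) /
              norm (gamma_quot a (Complex ((A + b * x) + b * real k) (b * y))))"
proof -
  have pos: "step (x + real k) > 0" for k using assms arg_pos by (intro step_pos) auto
  have "of_real A + of_real b * (Complex x y + of_nat k) = Complex ((A + b * x) + b * real k) (b * y)" for k
    by (simp add: complex_eq_iff algebra_simps)
  then have c: "cstep (Complex x y + of_nat k) = gamma_quot a (Complex ((A + b * x) + b * real k) (b * y))" for k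
    by (simp add: cstep_def)
  have r: "step (x + real k) = gamma_quot a ((A + b * x) + b * real k)" for k
    by (simp add: step_def algebra_simps)
  have "norm (capprox N (Complex x y)) = step N powr x * (\<Prod>k<N. norm (of_real (step (real k)) / cstep (Complex x y + of_nat k)))"
    using step_nat_pos[of N] by (simp add: capprox_def norm_mult prod_norm powr_def)
  also have "\<dots> = step N powr x * (\<Prod>k<N. (step (real k) / step (x + real k)) * (step (x + real k) / norm (cstep (Complex x y + of_nat k))))"
  proof -
    have "norm (of_real (step (real k)) / cstep (Complex x y + of_nat k)) =
      (step (real k) / step (x + real k)) * (step (x + real k) / norm (cstep (Complex x y + of_nat k)))" for k
      using pos[of k] step_nat_pos[of k] by (simp add: norm_divide)
    then show ?thesis by simp
  qed
  also have "\<dots> = approx N x * (\<Prod>k<N. step (x + real k) / norm (cstep (Complex x y + of_nat k)))"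
    unfolding approx_def prod.distrib by simp
  finally show ?thesis unfolding c r .
qed

text \<open>To the left of 0 this is \<open>approx_le_of_nonpos\<close>. To the right, extrapolation
  from -1 and 0 leaves a power of 1 / approx N (-1), which is bounded in \<open>N\<close> because it
  converges.\<close>

lemma approx_bounded:
  assumes "A + b * x0 > 0"
  obtains B where "\<And>N x. x0 \<le> x \<Longrightarrow> x \<le> X \<Longrightarrow> approx N x \<le> B"
proof -
  have "(\<lambda>N. inverse (approx N (-1))) \<longlonglongrightarrow> inverse (1 / step (-1))"
    using b step_pos[of "-1"] by (intro tendsto_intros approx_minus_1_tendsto) auto
  then have "Bseq (\<lambda>N. inverse (approx N (-1)))"
    by (intro convergent_imp_Bseq convergentI)
  then obtain K where K: "K > 0" "\<And>N. \<bar>inverse (approx N (-1))\<bar> \<le> K"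
    by (auto simp: Bseq_def)
  define K' where "K' = max 1 K"
  define s where "s = max 1 (inverse (step 0))"
  have "approx N x \<le> s powr \<bar>x0\<bar> + K' powr \<bar>X\<bar>" if x: "x0 \<le> x" "x \<le> X" for N x
  proof (cases "x \<le> 0")
    case True
    have "b * x0 \<le> b * x" using x b by simp
    then have "A + b * x > 0" using assms by linarith
    then have "approx N x \<le> step 0 powr x" using True by (rule approx_le_of_nonpos)
    also have "\<dots> = inverse (step 0) powr (- x)"
      using step_nat_pos[of 0] by (simp add: powr_minus inverse_powr)
    also have "\<dots> \<le> s powr (- x)"
      using True step_nat_pos[of 0] by (intro powr_mono2) (auto simp: s_def)
    also have "\<dots> \<le> s powr \<bar>x0\<bar>"
      using x True by (intro powr_mono) (auto simp: s_def)
    also have "\<dots> \<le> s powr \<bar>x0\<bar> + K' powr \<bar>X\<bar>" by simp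
    finally show ?thesis .
  next
    case False
    have p1: "approx N (-1) > 0" using b by (intro approx_pos) auto
    have "approx N x \<le> approx N 0 * (approx N 0 / approx N (-1)) powr ((x - 0) / (0 - (-1)))"
      using False b by (intro approx_le_extrapolate) auto
    also have "\<dots> = inverse (approx N (-1)) powr x" by (simp add: approx_0 inverse_eq_divide)
    also have "\<dots> \<le> K' powr x"
      using K(2)[of N] p1 False by (intro powr_mono2) (auto simp: K'_def)
    also have "\<dots> \<le> K' powr \<bar>X\<bar>"
      using x False by (intro powr_mono) (auto simp: K'_def)
    also have "\<dots> \<le> s powr \<bar>x0\<bar> + K' powr \<bar>X\<bar>" by simp
    finally show ?thesis .
  qed
  then show ?thesis using that by blast
qed

lemma capprox_bound:
  assumes "A + b * x0 > 0" "\<theta> > a * pi / 2"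
  obtains C where "C > 0"
    "\<And>x y N. x0 \<le> x \<Longrightarrow> norm (capprox N (Complex x y)) \<le> approx N x * C * exp (\<theta> * \<bar>y\<bar>)"
proof -
  have "\<theta> - a * pi / 2 > 0" using assms by simp
  from prod_gamma_quot_ratio_bound[OF a b(1) assms(1) this]
  obtain C where C: "C > 0" "\<And>u y N. u \<ge> A + b * x0 \<Longrightarrow>
       (\<Prod>k<N. gamma_quot a (u + b * real k) / norm (gamma_quot a (Complex (u + b * real k) (b * y))))
       \<le> C * exp ((a * pi / 2 + (\<theta> - a * pi / 2)) * \<bar>y\<bar>)" by blast
  have "norm (capprox N (Complex x y)) \<le> approx N x * C * exp (\<theta> * \<bar>y\<bar>)" if x: "x0 \<le> x" for x y N
  proof -
    have le: "A + b * x0 \<le> A + b * x" using x b by simp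
    then have pos: "A + b * x > 0" using assms by linarith
    show ?thesis
      unfolding norm_capprox[OF pos] using C(2)[OF le] approx_pos[OF pos, of N]
      by (simp add: mult.assoc)
  qed
  with C(1) show ?thesis using that by blast
qed

text \<open>The normality hypothesis for Montel's theorem.\<close>

lemma capprox_locally_bounded:
  assumes "compact K" "K \<subseteq> dom"
  shows "\<exists>B. \<forall>N. \<forall>z\<in>K. norm (capprox N z) \<le> B"
proof (cases "K = {}")
  case False
  have "continuous_on K Re" by (intro continuous_intros)
  from continuous_attains_inf[OF assms(1) False this]
  obtain z0 where z0: "z0 \<in> K" "\<And>z. z \<in> K \<Longrightarrow> Re z0 \<le> Re z" by blast
  obtain R where R: "\<And>z. z \<in> K \<Longrightarrow> norm z \<le> R"
    using compact_imp_bounded[OF assms(1)] by (auto simp: bounded_iff)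
  have x0: "A + b * Re z0 > 0" using z0 assms by (auto simp: dom_iff)
  obtain B where B: "\<And>N x. Re z0 \<le> x \<Longrightarrow> x \<le> R \<Longrightarrow> approx N x \<le> B"
    using approx_bounded[OF x0] by blast
  obtain C where C: "C > 0"
    "\<And>x y N. Re z0 \<le> x \<Longrightarrow> norm (capprox N (Complex x y)) \<le> approx N x * C * exp ((a * pi / 2 + 1) * \<bar>y\<bar>)"
    using capprox_bound[OF x0, of "a * pi / 2 + 1"] by auto
  have "norm (capprox N z) \<le> B * C * exp ((a * pi / 2 + 1) * R)" if z: "z \<in> K" for N z
  proof -
    have le: "Re z0 \<le> Re z" "Re z \<le> R" "\<bar>Im z\<bar> \<le> R"
      using z0 R z abs_Re_le_cmod[of z] abs_Im_le_cmod[of z] by (force intro: order_trans)+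
    have pos: "A + b * Re z > 0" using z assms by (auto simp: dom_iff)
    have "norm (capprox N z) \<le> approx N (Re z) * C * exp ((a * pi / 2 + 1) * \<bar>Im z\<bar>)"
      using C(2)[OF le(1), of N "Im z"] by simp
    also have "\<dots> \<le> B * C * exp ((a * pi / 2 + 1) * R)"
      using B[OF le(1,2), of N] approx_pos[OF pos, of N] C(1) le a
      by (intro mult_mono) (auto intro!: mult_left_mono mult_nonneg_nonneg)
    finally show ?thesis .
  qed
  then show ?thesis by blast
qed auto

section \<open>The interpolating function and the expansion of the series\<close>

text \<open>Montel's theorem yields a convergent subsequence of the approximants. The limit is
  identified only at the natural numbers and at -1, which are the poles met by the contour shift;
  the bounds survive the passage to the limit, with \<open>\<rho>\<close> the limit on the real
  axis.\<close>

lemma coeff_interpolation: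
  assumes x0: "A + b * x0 > 0" "x0 \<le> 0" and \<theta>: "\<theta> > a * pi / 2"
  obtains c \<rho> C where
    "c holomorphic_on dom" "\<And>n. c (of_nat n) = of_real (coeff n)" "c (-1) = of_real (1 / step (-1))"
    "C > 0" "\<And>x y. x0 \<le> x \<Longrightarrow> norm (c (Complex x y)) \<le> \<rho> x * C * exp (\<theta> * \<bar>y\<bar>)"
    "\<And>X. \<exists>B. \<forall>x. x0 \<le> x \<longrightarrow> x \<le> X \<longrightarrow> \<rho> x \<le> B"
    "\<And>n. \<rho> (real (Suc n) + 1 / 2) \<le> coeff (Suc n) * step n powr (1 / 2)"
proof -
  obtain c r where c: "c holomorphic_on dom" and r: "strict_mono (r :: nat \<Rightarrow> nat)"
    and lim: "\<And>z. z \<in> dom \<Longrightarrow> (\<lambda>n. capprox (r n) z) \<longlonglongrightarrow> c z"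
  proof (rule Montel[OF open_dom, of "range capprox" capprox])
    show "\<And>h. h \<in> range capprox \<Longrightarrow> h holomorphic_on dom"
      using capprox_holomorphic by auto
    show "\<And>K. compact K \<Longrightarrow> K \<subseteq> dom \<Longrightarrow> \<exists>B. \<forall>h\<in>range capprox. \<forall>z\<in>K. norm (h z) \<le> B"
      using capprox_locally_bounded by auto
  qed auto
  define \<rho> where "\<rho> = (\<lambda>x. Re (c (of_real x)))"
  have lim_real: "(\<lambda>n. approx (r n) x) \<longlonglongrightarrow> \<rho> x" if "A + b * x > 0" for x
    using tendsto_Re[OF lim[of "of_real x"]] that by (simp add: dom_iff \<rho>_def capprox_of_real)
  obtain C where C: "C > 0"
    "\<And>x y N. x0 \<le> x \<Longrightarrow> norm (capprox N (Complex x y)) \<le> approx N x * C * exp (\<theta> * \<bar>y\<bar>)"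
    using capprox_bound[OF x0(1) \<theta>] by blast
  have pos: "A + b * x > 0" if "x0 \<le> x" for x
  proof -
    have "b * x0 \<le> b * x" using that b by simp
    then show ?thesis using x0 by linarith
  qed
  have real_lim: "c (of_real x) = of_real L" if "A + b * x > 0" "(\<lambda>N. approx N x) \<longlonglongrightarrow> L" for x L
  proof (rule LIMSEQ_unique)
    show "(\<lambda>n. capprox (r n) (of_real x)) \<longlonglongrightarrow> c (of_real x)"
      using that by (intro lim) (simp add: dom_iff)
    show "(\<lambda>n. capprox (r n) (of_real x)) \<longlonglongrightarrow> of_real L"
      unfolding capprox_of_real using LIMSEQ_subseq_LIMSEQ[OF that(2) r]
      by (intro tendsto_of_real) (simp add: o_def)
  qed
  show ?thesis
  proof (rule that[OF c _ _ C(1)])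
    show c_nat: "c (of_nat n) = of_real (coeff n)" for n
      using real_lim[OF pos approx_nat_tendsto[of n]] x0 by simp
    show "c (-1) = of_real (1 / step (-1))"
      using real_lim[OF _ approx_minus_1_tendsto] b by simp
    show "norm (c (Complex x y)) \<le> \<rho> x * C * exp (\<theta> * \<bar>y\<bar>)" if x: "x0 \<le> x" for x y
    proof (rule LIMSEQ_le)
      show "(\<lambda>n. norm (capprox (r n) (Complex x y))) \<longlonglongrightarrow> norm (c (Complex x y))"
        using pos[OF x] by (intro tendsto_norm lim) (simp add: dom_iff)
      show "(\<lambda>n. approx (r n) x * C * exp (\<theta> * \<bar>y\<bar>)) \<longlonglongrightarrow> \<rho> x * C * exp (\<theta> * \<bar>y\<bar>)"
        using pos[OF x] by (intro tendsto_intros lim_real)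
    qed (use C(2)[OF x] in blast)
    show "\<exists>B. \<forall>x. x0 \<le> x \<longrightarrow> x \<le> X \<longrightarrow> \<rho> x \<le> B" for X
    proof -
      obtain B where B: "\<And>N x. x0 \<le> x \<Longrightarrow> x \<le> X \<Longrightarrow> approx N x \<le> B"
        using approx_bounded[OF x0(1)] by blast
      have "\<rho> x \<le> B" if "x0 \<le> x" "x \<le> X" for x
        using lim_real[OF pos[OF that(1)]] B[OF that] by (intro LIMSEQ_le_const2) auto
      then show ?thesis by blast
    qed
    show "\<rho> (real (Suc n) + 1 / 2) \<le> coeff (Suc n) * step n powr (1 / 2)" for n
    proof (rule LIMSEQ_le)
      have p: "A + b * real k > 0" "A + b * (real k + 1 / 2) > 0" for k
        using b by (auto intro!: add_pos_nonneg)
      show "(\<lambda>k. approx (r k) (real (Suc n) + 1 / 2)) \<longlonglongrightarrow> \<rho> (real (Suc n) + 1 / 2)"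
        by (intro lim_real p)
      have l: "(\<lambda>k. approx (r k) (real n)) \<longlonglongrightarrow> coeff n" for n
        using LIMSEQ_subseq_LIMSEQ[OF approx_nat_tendsto r] by (simp add: o_def)
      have "(\<lambda>k. approx (r k) (real (Suc n)) * (approx (r k) (real (Suc n)) / approx (r k) (real n)) powr (1 / 2))
         \<longlonglongrightarrow> coeff (Suc n) * (coeff (Suc n) / coeff n) powr (1 / 2)"
        using coeff_pos[of n] coeff_pos[of "Suc n"]
        by (intro tendsto_mult tendsto_powr tendsto_divide tendsto_const l) (auto simp: less_imp_neq[symmetric])
      also have "coeff (Suc n) / coeff n = step n"
        using coeff_pos[of n] by (simp add: coeff_Suc)
      finally show "(\<lambda>k. approx (r k) (real (Suc n)) * (approx (r k) (real (Suc n)) / approx (r k) (real n)) powr (1 / 2))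
         \<longlonglongrightarrow> coeff (Suc n) * step n powr (1 / 2)" .
      \<comment> \<open>Extrapolation from n and n + 1 to n + 3/2, half a unit beyond a unit
        interval; hence the exponent 1/2.\<close>
      show "\<exists>N. \<forall>k\<ge>N. approx (r k) (real (Suc n) + 1 / 2) \<le>
         approx (r k) (real (Suc n)) * (approx (r k) (real (Suc n)) / approx (r k) (real n)) powr (1 / 2)"
        using approx_le_extrapolate[OF p(1), of n "real (Suc n)" "real (Suc n) + 1 / 2"] by simp
    qed
  qed
qed

lemma coeff_summable: "summable (\<lambda>n. complex_of_real (coeff n) * z ^ n)"
proof -
  have "(\<lambda>n. step (real n) * norm z) \<longlonglongrightarrow> 0 * norm z"
    by (intro tendsto_intros step_tendsto_0)
  then have "\<forall>\<^sub>F n in sequentially. step (real n) * norm z < 1 / 2"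
    by (intro order_tendstoD) auto
  then obtain N where N: "\<And>n. n \<ge> N \<Longrightarrow> step (real n) * norm z < 1 / 2"
    by (auto simp: eventually_sequentially)
  show ?thesis
  proof (rule summable_ratio_test)
    fix n assume "n \<ge> N"
    from N[OF this] have "norm (complex_of_real (coeff n) * z ^ n) * (step (real n) * norm z)
        \<le> norm (complex_of_real (coeff n) * z ^ n) * (1 / 2)"
      by (intro mult_left_mono) auto
    then show "norm (complex_of_real (coeff (Suc n)) * z ^ Suc n) \<le> 1 / 2 * norm (complex_of_real (coeff n) * z ^ n)"
      using step_nat_pos[of n] by (simp add: coeff_Suc norm_mult mult_ac)
  qed simp
qed

theorem coeff_series_remainder:
  assumes x0: "- A / b < x0" "- 2 < x0" "x0 < - 1"
  obtains L where "\<And>z. Re z > 0 \<Longrightarrow>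
    norm ((\<Sum>n. complex_of_real (coeff n) * (- z) ^ n) - of_real (1 / step (- 1)) / z) \<le> L * norm z powr x0"
proof -
  \<comment> \<open>The midpoint between the vertical growth rate a pi / 2 of the approximants and
    the admissible limit pi / 2.\<close>
  define \<theta> where "\<theta> = (1 + a) * pi / 4"
  have "a * pi < pi" using a by simp
  then have \<theta>: "\<theta> > a * pi / 2" "\<theta> < pi / 2"
    by (simp_all add: \<theta>_def field_simps)
  have p0: "A + b * x0 > 0" using x0 b by (simp add: field_simps)
  have "x0 \<le> 0" using x0 by simp
  from coeff_interpolation[OF p0 this \<theta>(1)] obtain c \<rho> C where
    c: "c holomorphic_on dom" "\<And>n. c (of_nat n) = of_real (coeff n)" "c (-1) = of_real (1 / step (-1))"
    and C: "C > 0" "\<And>x y. x0 \<le> x \<Longrightarrow> norm (c (Complex x y)) \<le> \<rho> x * C * exp (\<theta> * \<bar>y\<bar>)"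
    and \<rho>: "\<And>X. \<exists>B. \<forall>x. x0 \<le> x \<longrightarrow> x \<le> X \<longrightarrow> \<rho> x \<le> B"
    "\<And>n. \<rho> (real (Suc n) + 1 / 2) \<le> coeff (Suc n) * step n powr (1 / 2)"
    by metis
  \<comment> \<open>The majorant is a term of an everywhere convergent series times a factor tending
    to 0. The index is shifted because \<open>\<rho>\<close> is bounded only from 3/2 on.\<close>
  have decay: "(\<lambda>n. \<rho> (real n + 1 / 2) * r powr (real n + 1 / 2)) \<longlonglongrightarrow> 0" if r: "r > 0" for r
  proof (rule LIMSEQ_imp_Suc, rule tendsto_sandwich)
    show "\<forall>\<^sub>F n in sequentially. 0 \<le> \<rho> (real (Suc n) + 1 / 2) * r powr (real (Suc n) + 1 / 2)"
    proof (intro always_eventually allI mult_nonneg_nonneg)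
      fix n
      have "x0 \<le> real (Suc n) + 1 / 2" using x0 by linarith
      from order_trans[OF norm_ge_zero C(2)[OF this, of 0]]
      show "0 \<le> \<rho> (real (Suc n) + 1 / 2)" using C(1) by (simp add: zero_le_mult_iff)
    qed simp
    show "\<forall>\<^sub>F n in sequentially. \<rho> (real (Suc n) + 1 / 2) * r powr (real (Suc n) + 1 / 2) \<le>
        coeff (Suc n) * r ^ Suc n * (sqrt (step (real n)) * r powr (1 / 2))"
    proof (intro always_eventually allI)
      fix n
      have "r powr (real (Suc n) + 1 / 2) = r ^ Suc n * r powr (1 / 2)"
        unfolding powr_add using r by (simp add: powr_realpow del: power_Suc of_nat_Suc)
      moreover have "step (real n) powr (1 / 2) = sqrt (step (real n))"
        using step_nat_pos[of n] by (simp add: powr_half_sqrt)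
      ultimately show "\<rho> (real (Suc n) + 1 / 2) * r powr (real (Suc n) + 1 / 2) \<le>
          coeff (Suc n) * r ^ Suc n * (sqrt (step (real n)) * r powr (1 / 2))"
        using mult_right_mono[OF \<rho>(2)[of n], of "r ^ Suc n * r powr (1 / 2)"] r
        by (simp add: mult_ac)
    qed
    have c0: "(\<lambda>n. coeff n * r ^ n) \<longlonglongrightarrow> 0"
      using tendsto_Re[OF summable_LIMSEQ_zero[OF coeff_summable[of "of_real r"]]]
      by (simp flip: of_real_power of_real_mult)
    have s0: "(\<lambda>n. sqrt (step (real n))) \<longlonglongrightarrow> sqrt 0"
      by (intro tendsto_real_sqrt step_tendsto_0)
    from tendsto_mult[OF LIMSEQ_Suc[OF c0] tendsto_mult[OF s0 tendsto_const[of "r powr (1 / 2)"]]]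
    show "(\<lambda>n. coeff (Suc n) * r ^ Suc n * (sqrt (step (real n)) * r powr (1 / 2))) \<longlonglongrightarrow> 0"
      by simp
  qed simp
  have summ: "summable (\<lambda>n. c (of_nat n) * z ^ n)" for z
    using coeff_summable by (simp add: c(2))
  obtain L where "\<And>z. Re z > 0 \<Longrightarrow>
    norm ((\<Sum>n. c (of_nat n) * (- z) ^ n) - c (- 1) / z) \<le> L * norm z powr x0"
    using alternating_power_series_remainder[OF c(1)[unfolded dom_def] x0 \<theta>(2) C \<rho>(1) decay summ] by blast
  then show ?thesis
    using that unfolding c(2,3) by blast
qed

end

theorem theorem2p3:
  fixes a m l :: real
  assumes "0 < a" and "a < 1" and "m > 0" and "l > m - 1 / a"
  shows "\<exists>\<delta>::real. 1 < \<delta> \<and> \<delta> \<le> 3 / 2 \<and>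
    (\<lambda>z. kilbas_saigo a m l (- z)
          - complex_of_real (Gamma (1 + a * (l - m + 1)) / Gamma (1 + a * (l - m))) * inverse z)
      \<in> O[inf at_infinity (principal {z::complex. Re z > 0})](\<lambda>z. complex_of_real (norm z powr (- \<delta>)))"
proof -
  define A where "A = 1 + a * l"
  define b where "b = a * m"
  have "a * (m - 1 / a) < a * l" using assms by (intro mult_strict_left_mono) auto
  then have "b < A" using assms by (simp add: A_def b_def right_diff_distrib)
  moreover have "b > 0" using assms by (simp add: b_def)
  ultimately interpret kilbas_saigo_setup a A b
    using assms by unfold_locales auto
  define q where "q = A / b"
  \<comment> \<open>The midpoint of 1 and \<open>q\<close> keeps the line Re s =
    -\<open>\<delta>\<close> inside \<open>dom\<close> and to the left of -1; the cap 3/2 keeps it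
    to the right of -2.\<close>
  define \<delta> where "\<delta> = min (3 / 2) ((1 + q) / 2)"
  have "q > 1" using b by (simp add: q_def)
  then have "1 < \<delta>" "\<delta> \<le> 3 / 2" "\<delta> < q" by (auto simp: \<delta>_def min_def)
  then have \<delta>: "1 < \<delta>" "\<delta> \<le> 3 / 2" "\<delta> < A / b" by (simp_all add: q_def)
  have coeff: "kilbas_saigo_coeff a m l n = coeff n" for n
    unfolding kilbas_saigo_coeff_def coeff_def step_def gamma_quot_def
    unfolding A_def b_def by (simp add: algebra_simps)
  \<comment> \<open>Here A - b = 1 + a (l - m), so the leading constant is the interpolated
    coefficient c(-1).\<close>
  have step: "Gamma (1 + a * (l - m + 1)) / Gamma (1 + a * (l - m)) = 1 / step (- 1)"
    unfolding step_def gamma_quot_def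
    unfolding A_def b_def by (simp add: algebra_simps)
  obtain L where L: "\<And>z. Re z > 0 \<Longrightarrow>
    norm ((\<Sum>n. complex_of_real (coeff n) * (- z) ^ n) - of_real (1 / step (- 1)) / z) \<le> L * norm z powr (- \<delta>)"
    using coeff_series_remainder[of "- \<delta>"] \<delta> by auto
  have "(\<lambda>z. kilbas_saigo a m l (- z)
          - complex_of_real (Gamma (1 + a * (l - m + 1)) / Gamma (1 + a * (l - m))) * inverse z)
      \<in> O[inf at_infinity (principal {z::complex. Re z > 0})](\<lambda>z. complex_of_real (norm z powr (- \<delta>)))"
  proof (rule bigoI[of _ L])
    show "\<forall>\<^sub>F z in inf at_infinity (principal {z. Re z > 0}).
        norm (kilbas_saigo a m l (- z)
          - complex_of_real (Gamma (1 + a * (l - m + 1)) / Gamma (1 + a * (l - m))) * inverse z)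
        \<le> L * norm (complex_of_real (norm z powr (- \<delta>)))"
      unfolding eventually_inf_principal kilbas_saigo_def coeff step divide_inverse[symmetric]
      using L by (intro always_eventually) simp
  qed
  with \<delta> show ?thesis by blast
qed

end
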